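(* Let $n$ and $N$ be positive integers with $1\leq n\leq N$. Then \[ \mathcal S_n\subseteq\mathcal R_n\subseteq\mathcal C_n\subseteq\mathcal V_n. \] Moreover, if $N\geq3$ and $(p,q)$ is a pair of primes compatible with $N$, then: (i) $m_t(\alpha_n)=\min\{f_{\mathbf x}(t):\mathbf x\in\mathcal C_n\}$ for all $t>0$; (ii) if $m_t(\alpha_i)=\min\{f_{\mathbf x}(t):\mathbf x\in\mathcal S_i\}$ for all $1\leq i<n$ and all $t>0$, then $m_t(\alpha_n)=\min\{f_{\mathbf x}(t):\mathbf x\in\mathcal R_n\}$ for all $t>0$.
   Context: $(h_k)_{k\geq0}$ is the Fibonacci sequence, $h_0=0$, $h_1=1$, $h_{k+1}=h_k+h_{k-1}$. For a nonzero algebraic number $\alpha$ with minimal polynomial over $\mathbb Z$ equal to $a\prod_{i=1}^d(z-\alpha_i)$, $m(\alpha)=\log|a|+\sum_i\log\max\{1,|\alpha_i|\}$; for coprime nonzero integers $r,s$, $m(r/s)=\log\max\{|r|,|s|\}$. A product representation of $\alpha$ is a tuple $\bar\beta=(\beta_1,\ldots,\beta_M)$ of nonzero algebraic numbers with product $\alpha$; $\mathcal P(\alpha)$ is the set of these; $f_{\bar\beta}(t)=(\sum_k m(\beta_k)^t)^{1/t}$ and $m_t(\alpha)=\inf\{f_{\bar\beta}(t):\bar\beta\in\mathcal P(\alpha)\}$ for $t>0$. Let $A$ be the $2\times N$ matrix with rows $(h_1,\ldots,h_N)$ and $(h_0,\ldots,h_{N-1})$. For $1\leq n\leq N$, $\mathcal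 V_n=\{\mathbf x\in\mathbb Z_{\geq0}^N:A\mathbf x=(h_n,h_{n-1})^T\}$, $\alpha_n=p^{h_n}/q^{h_{n-1}}$, and for $\mathbf x=(x_1,\ldots,x_N)\in\mathcal V_n$, $f_{\mathbf x}(t)=(\sum_{i=1}^N x_i\,m(p^{h_i}/q^{h_{i-1}})^t)^{1/t}$. For $2\leq n\leq N$ and $3\leq i\leq n+1$, $\mathbf x_n(i)\in\mathbb R^N$ has entry $h_{n+1-i}$ in position $i-2$, $h_{n+2-i}$ in position $i-1$, and $0$ elsewhere; $\mathcal S_n=\{\mathbf x_n(i):3\leq i\leq n+1\}$; $\mathbf x_1(2)=(1,0,\ldots,0)$ and $\mathcal S_1=\{\mathbf x_1(2)\}$. $\mathbf z=(z_1,\ldots,z_N)\in\mathcal V_n$ is almost consecutive-free if $z_jz_{j+1}\neq0$ implies $z_i=0$ for all $i>j+1$; $\mathcal C_n$ is the set of almost consecutive-free elements of $\mathcal V_n$. A factorization of $\mathbf z\in\mathcal V_n$ is a tuple $(\mathbf x_1,\ldots,\mathbf x_K)$ with each $\mathbf x_k\in\bigcup_{i=1}^n\mathcal V_i$ and $\mathbf z=\sum_k\mathbf x_k$ (factorizations differing by a permutation are identified); the trivial factorization is $(\mathbf z)$ with $K=1$. A factorization is $\mathcal S$-type if every $\mathbf x_k\in\bigcup_{i=1}^n\mathcal S_i$. $\mathbf z$ is $\mathcal S$-restricted if all its non-trivial factorizations are $\mathcal S$-type; $\mathcal R_n$ is the set of $\mathcal S$-restricted elements of $\mathcal C_n$.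 Condition (W) on primes $p,q$: $\frac{h_N}{h_{N-1}}<\frac{\log q}{\log p}<\frac{h_{N-1}}{h_{N-2}}$ or $\frac{h_{N-1}}{h_{N-2}}<\frac{\log q}{\log p}<\frac{h_N}{h_{N-1}}$. Under (W), for $n\geq3$, $t_n$ is the unique positive real with $m(p^{h_n}/q^{h_{n-1}})^{t_n}=m(p^{h_{n-1}}/q^{h_{n-2}})^{t_n}+m(p^{h_{n-2}}/q^{h_{n-3}})^{t_n}$. $(p,q)$ is compatible with $N$ if it satisfies (W) and $t_{N+1}<t_N<\cdots<t_3$. *)

theory Defs
  imports
    "HOL-Number_Theory.Number_Theory"
    "HOL-Computational_Algebra.Computational_Algebra"
begin

section \<open>Logarithmic Mahler measure and its \<open>t\<close>-metric version\<close>

text \<open>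
  Algebraic numbers are complex numbers satisfying \<^const>\<open>algebraic\<close>. An irreducible element of
  \<open>int poly\<close> of positive degree is automatically primitive, so for algebraic \<open>\<alpha>\<close> the
  polynomial below exists and is unique.
\<close>

definition min_poly_int :: "complex \<Rightarrow> int poly" where
  "min_poly_int \<alpha> =
     (THE P. irreducible P \<and> lead_coeff P > 0 \<and> poly (map_poly of_int P) \<alpha> = 0)"

definition log_mahler :: "complex \<Rightarrow> real" where
  "log_mahler \<alpha> =
     ln \<bar>real_of_int (lead_coeff (min_poly_int \<alpha>))\<bar>
       + (\<Sum>z\<in>#proots (map_poly of_int (min_poly_int \<alpha>)). ln (max 1 (cmod z)))"

definition product_representations :: "complex \<Rightarrow> complex list set" where
  "product_representations \<alpha> =
     {\<beta>s. \<beta>s \<noteq> [] \<and> (\<forall>\<beta>\<in>set \<beta>s. algebraic \<beta> \<and> \<beta> \<noteq> 0) \<and> prod_list \<beta>s = \<alpha>}"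

definition f_rep :: "complex list \<Rightarrow> real \<Rightarrow> real" where
  "f_rep \<beta>s t = (\<Sum>\<beta>\<leftarrow>\<beta>s. log_mahler \<beta> powr t) powr (1 / t)"

definition metric_mahler :: "real \<Rightarrow> complex \<Rightarrow> real" where
  "metric_mahler t \<alpha> = (INF \<beta>s \<in> product_representations \<alpha>. f_rep \<beta>s t)"


section \<open>The numbers \<open>\<alpha>\<^sub>n\<close>\<close>

definition fib_quot :: "nat \<Rightarrow> nat \<Rightarrow> nat \<Rightarrow> complex" where
  "fib_quot p q n = of_nat p ^ fib n / of_nat q ^ fib (n - 1)"

definition f_vec :: "nat \<Rightarrow> nat \<Rightarrow> nat \<Rightarrow> (nat \<Rightarrow> nat) \<Rightarrow> real \<Rightarrow> real" where
  "f_vec N p q x t =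
     (\<Sum>i=1..N. real (x i) * log_mahler (fib_quot p q i) powr t) powr (1 / t)"


section \<open>Sets of integer vectors\<close>

text \<open>
  Vectors with \<open>N\<close> non-negative integer entries are functions \<open>x :: nat \<Rightarrow> nat\<close>, indexed from 1 as
  in \<open>x\<^sub>1, \<dots>, x\<^sub>N\<close> and vanishing outside \<open>{1..N}\<close> (so that equality of vectors is equality of
  functions).
\<close>

definition nat_vecs :: "nat \<Rightarrow> (nat \<Rightarrow> nat) set" where
  "nat_vecs N = {x. \<forall>j. j \<notin> {1..N} \<longrightarrow> x j = 0}"

text \<open>The \<open>2 \<times> N\<close> matrix \<open>A\<close>, with rows indexed by 1 and 2 and columns by \<open>1, \<dots>, N\<close>.\<close>

definition fib_mat :: "nat \<Rightarrow> nat \<Rightarrow> nat" where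
  "fib_mat i j = (if i = 1 then fib j else fib (j - 1))"

definition V_set :: "nat \<Rightarrow> nat \<Rightarrow> (nat \<Rightarrow> nat) set" where
  "V_set N n = {x \<in> nat_vecs N.
     (\<Sum>j=1..N. fib_mat 1 j * x j) = fib n \<and>
     (\<Sum>j=1..N. fib_mat 2 j * x j) = fib (n - 1)}"

text \<open>The vector \<open>x\<^sub>n(i)\<close>, for \<open>3 \<le> i \<le> n + 1\<close> (so no subtraction truncates).\<close>

definition S_vec :: "nat \<Rightarrow> nat \<Rightarrow> nat \<Rightarrow> nat" where
  "S_vec n i = (\<lambda>j. if j = i - 2 then fib (n + 1 - i)
                    else if j = i - 1 then fib (n + 2 - i) else 0)"

definition S_set :: "nat \<Rightarrow> (nat \<Rightarrow> nat) set" where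
  "S_set n = (if n = 1 then {\<lambda>j. if j = 1 then 1 else 0} else S_vec n ` {3..n + 1})"

definition almost_consecutive_free :: "(nat \<Rightarrow> nat) \<Rightarrow> bool" where
  "almost_consecutive_free z \<longleftrightarrow>
     (\<forall>j. z j * z (j + 1) \<noteq> 0 \<longrightarrow> (\<forall>i > j + 1. z i = 0))"

definition C_set :: "nat \<Rightarrow> nat \<Rightarrow> (nat \<Rightarrow> nat) set" where
  "C_set N n = {z \<in> V_set N n. almost_consecutive_free z}"

text \<open>Factorizations are multisets, since they are identified up to permutation.\<close>

definition factorizations :: "nat \<Rightarrow> nat \<Rightarrow> (nat \<Rightarrow> nat) \<Rightarrow> (nat \<Rightarrow> nat) multiset set" where
  "factorizations N n z =
     {F. set_mset F \<subseteq> (\<Union>i\<in>{1..n}. V_set N i) \<and> (\<forall>j. z j = (\<Sum>x\<in>#F. x j))}"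

definition S_type :: "nat \<Rightarrow> (nat \<Rightarrow> nat) multiset \<Rightarrow> bool" where
  "S_type n F \<longleftrightarrow> set_mset F \<subseteq> (\<Union>i\<in>{1..n}. S_set i)"

definition S_restricted :: "nat \<Rightarrow> nat \<Rightarrow> (nat \<Rightarrow> nat) \<Rightarrow> bool" where
  "S_restricted N n z \<longleftrightarrow> (\<forall>F \<in> factorizations N n z. F \<noteq> {#z#} \<longrightarrow> S_type n F)"

definition R_set :: "nat \<Rightarrow> nat \<Rightarrow> (nat \<Rightarrow> nat) set" where
  "R_set N n = {z \<in> C_set N n. S_restricted N n z}"

text \<open>
  Hence \<^const>\<open>Min\<close> over the values of a function on any subset of \<^term>\<open>V_set N n\<close> is a genuine
  minimum as soon as the subset is nonempty.
\<close>

lemma finite_V_set: "finite (V_set N n)"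
proof -
  have "x j \<le> fib n" if x: "x \<in> V_set N n" and j: "j \<in> {1..N}" for x j
  proof -
    have "x j \<le> fib_mat 1 j * x j"
      using j fib_neq_0_nat[of j] by (simp add: fib_mat_def)
    also have "\<dots> \<le> (\<Sum>j=1..N. fib_mat 1 j * x j)"
      using j by (intro member_le_sum) auto
    also have "\<dots> = fib n" using x by (simp add: V_set_def)
    finally show ?thesis .
  qed
  then have "V_set N n \<subseteq>
      {x. \<forall>j. (j \<in> {1..N} \<longrightarrow> x j \<in> {..fib n}) \<and> (j \<notin> {1..N} \<longrightarrow> x j = 0)}"
    by (auto simp: V_set_def nat_vecs_def)
  then show ?thesis
    by (rule finite_subset) (rule finite_set_of_finite_funs; simp)
qed


section \<open>Compatible pairs of primes\<close>

definition cond_W :: "nat \<Rightarrow> nat \<Rightarrow> nat \<Rightarrow> bool" where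
  "cond_W N p q \<longleftrightarrow>
     (let r = ln (real q) / ln (real p);
          a = real (fib N) / real (fib (N - 1));
          b = real (fib (N - 1)) / real (fib (N - 2))
      in a < r \<and> r < b \<or> b < r \<and> r < a)"

definition t_crit :: "nat \<Rightarrow> nat \<Rightarrow> nat \<Rightarrow> real" where
  "t_crit p q n = (THE t. t > 0 \<and>
     log_mahler (fib_quot p q n) powr t =
       log_mahler (fib_quot p q (n - 1)) powr t + log_mahler (fib_quot p q (n - 2)) powr t)"

definition compatible :: "nat \<Rightarrow> nat \<Rightarrow> nat \<Rightarrow> bool" where
  "compatible N p q \<longleftrightarrow>
     cond_W N p q \<and> (\<forall>n \<in> {3..N}. t_crit p q (n + 1) < t_crit p q n)"

end

theory Submission
  imports
    Defs
    "Jordan_Normal_Form.Char_Poly"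
    "HOL-Complex_Analysis.Conformal_Mappings"
    "HOL-Library.Product_Plus"
begin

text \<open>
  If \<open>\<beta>\<^sub>1 \<cdots> \<beta>\<^sub>M = p\<^sup>h / q\<^sup>k\<close> and \<open>L\<^sub>i\<close>, \<open>C\<^sub>i\<close> are the leading and constant coefficients of the minimal
  polynomial of \<open>\<beta>\<^sub>i\<close>, then \<open>\<Prod> L\<^sub>i\<beta>\<^sub>i\<close> and \<open>\<Prod> C\<^sub>i/\<beta>\<^sub>i\<close> are rational algebraic integers, so
  \<open>q\<^sup>k\<close> divides \<open>\<Prod> L\<^sub>i\<close> and \<open>p\<^sup>h\<close> divides \<open>\<Prod> C\<^sub>i\<close>. As \<open>m(\<beta>\<^sub>i)\<close> is at least \<open>log |L\<^sub>i|\<close> and \<open>log |C\<^sub>i|\<close>, the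
  metric Mahler measure is the minimal cost of writing \<open>(h, k)\<close> as a sum of pairs of naturals, a
  pair \<open>(a, b)\<close> costing \<open>max (a log p) (b log q)\<^sup>t\<close>.

  For \<open>t \<le> 1\<close> merging all pairs is optimal. For \<open>t > 1\<close>, consider a sum of minimal cost and, among
  those, with few parts. Condition (W) makes \<open>h\<^sub>i log p - h\<^sub>i\<^sub>-\<^sub>1 log q\<close> alternate in sign for
  \<open>i \<le> N\<close>, and every pair is a sum of vectors \<open>(h\<^sub>i, h\<^sub>i\<^sub>-\<^sub>1)\<close> of a single parity, on which the weight is
  additive; so by superadditivity of \<open>x \<mapsto> x\<^sup>t\<close> only these vectors occur. If the indices \<open>j\<close>, \<open>j + 1\<close>
  and \<open>i > j + 1\<close> all occur, then not merging \<open>j\<close> and \<open>j + 1\<close> forces \<open>t > t\<^sub>j\<^sub>+\<^sub>2\<close>, and not splitting \<open>i\<close>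
  forces \<open>t \<le> t\<^sub>i \<le> t\<^sub>j\<^sub>+\<^sub>2\<close>; hence optimal vectors are almost consecutive-free.

  For (ii), let \<open>z\<close> be optimal at \<open>t\<close> but not \<open>S\<close>-restricted. Replacing a factor \<open>x\<close> outside the
  sets \<open>S\<^sub>i\<close> by an optimal \<open>s \<in> S\<^sub>i\<close> shows that the different exponential sums of \<open>x\<close> and \<open>s\<close> agree
  at \<open>t\<close>, which happens for only countably many \<open>t\<close>; continuity in \<open>t\<close> handles the rest.
\<close>

section \<open>Algebraic integers\<close>

text \<open>The nonzero vector \<open>u\<close> is an eigenvector of the integer matrix
  \<open>a\<close> for the eigenvalue \<open>x\<close>, so \<open>x\<close> is a root of the
  characteristic polynomial, which is monic with integer coefficients.\<close>

lemma algebraic_int_if_stable_span: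
  fixes x :: complex and u :: "'i \<Rightarrow> complex" and a :: "'i \<Rightarrow> 'i \<Rightarrow> int"
  assumes fin: "finite I" and nz: "k \<in> I" "u k \<noteq> 0"
    and stable: "\<And>i. i \<in> I \<Longrightarrow> x * u i = (\<Sum>j\<in>I. of_int (a i j) * u j)"
  shows "algebraic_int x"
proof -
  define n where "n = card I"
  from ex_bij_betw_nat_finite[OF fin] obtain h where h: "bij_betw h {0..<n} I"
    unfolding n_def by blast
  define A where "A = Matrix.mat n n (\<lambda>(i, j). a (h i) (h j))"
  define v where "v = Matrix.vec n (\<lambda>i. u (h i))"
  have A: "A \<in> carrier_mat n n" by (simp add: A_def)
  obtain i0 where i0: "i0 < n" "h i0 = k"
    using h nz(1) by (auto simp: bij_betw_def image_iff)
  have "v \<noteq> 0\<^sub>v n"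
  proof
    assume "v = 0\<^sub>v n"
    then have "vec_index v i0 = 0" using i0 by simp
    then show False using i0 nz by (simp add: v_def)
  qed
  moreover have "map_mat of_int A *\<^sub>v v = x \<cdot>\<^sub>v v"
  proof (rule eq_vecI)
    fix i assume "i < dim_vec (x \<cdot>\<^sub>v v)"
    then have i: "i < n" by (simp add: v_def)
    have "vec_index (map_mat of_int A *\<^sub>v v) i = (\<Sum>j\<in>{0..<n}. of_int (a (h i) (h j)) * u (h j))"
      using i by (simp add: A_def v_def scalar_prod_def)
    also have "\<dots> = (\<Sum>j\<in>I. of_int (a (h i) j) * u j)"
      by (rule sum.reindex_bij_betw[OF h])
    also have "\<dots> = x * u (h i)"
      using stable[of "h i"] h i by (auto simp: bij_betw_def)
    finally show "vec_index (map_mat of_int A *\<^sub>v v) i = vec_index (x \<cdot>\<^sub>v v) i" using i by (simp add: v_def)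
  qed (simp add: A_def v_def)
  ultimately have "eigenvalue (map_mat of_int A) x"
    unfolding eigenvalue_def eigenvector_def by (auto simp: A_def v_def intro!: exI[of _ v])
  then have "poly (char_poly (map_mat of_int A)) x = 0"
    using eigenvalue_root_char_poly[of "map_mat of_int A" n x] A by simp
  then have "poly (map_poly of_int (char_poly A)) x = 0"
    by (simp add: of_int_hom.char_poly_hom[OF A])
  moreover have "lead_coeff (char_poly A) = 1"
    using degree_monic_char_poly[OF A] by simp
  ultimately show ?thesis by (auto simp: algebraic_int_altdef_ipoly)
qed

text \<open>The powers of \<open>x\<close> below the degree of a monic integer polynomial vanishing
  at \<open>x\<close> span a module stable under multiplication by \<open>x\<close>;
  \<open>c\<close> is the companion matrix.\<close>

lemma algebraic_int_stable_powers:
  fixes x :: complex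
  assumes "algebraic_int x"
  obtains n c where "n > 0" and
    "\<And>i. i < n \<Longrightarrow> x * x ^ i = (\<Sum>j<n. of_int (c i j) * x ^ j)"
proof -
  obtain p where p: "poly (map_poly of_int p) x = 0" "lead_coeff p = 1"
    using assms by (auto simp: algebraic_int_altdef_ipoly)
  define n where "n = degree p"
  have "n > 0"
  proof (rule ccontr)
    assume "\<not> n > 0"
    then have "degree p = 0" by (simp add: n_def)
    then obtain b where "p = [:b:]" by (rule degree_eq_zeroE)
    with p show False by simp
  qed
  have deg: "degree (map_poly (of_int :: int \<Rightarrow> complex) p) = n"
    by (simp add: n_def)
  have "0 = (\<Sum>i\<le>n. of_int (coeff p i) * x ^ i)"
    using p(1) deg by (simp add: poly_altdef coeff_map_poly n_def)
  also have "\<dots> = (\<Sum>i<n. of_int (coeff p i) * x ^ i) + x ^ n"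
    using p(2) by (simp add: lessThan_Suc_atMost[symmetric] n_def)
  finally have top: "x ^ n = (\<Sum>j<n. of_int (- coeff p j) * x ^ j)"
    by (simp add: sum_negf eq_neg_iff_add_eq_0 add.commute)
  define c where "c i j = (if Suc i = n then - coeff p j else if j = Suc i then 1 else 0)" for i j
  have "x * x ^ i = (\<Sum>j<n. of_int (c i j) * x ^ j)" if "i < n" for i
  proof (cases "Suc i = n")
    case True
    then show ?thesis using top by (auto simp: c_def)
  next
    case False
    then have "(\<Sum>j<n. of_int (c i j) * x ^ j) = (\<Sum>j<n. if j = Suc i then x ^ j else 0)"
      by (intro sum.cong) (auto simp: c_def)
    also have "\<dots> = x * x ^ i" using that False by (simp add: sum.delta)
    finally show ?thesis by simp
  qed
  with \<open>n > 0\<close> show ?thesis using that by blast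
qed

text \<open>The products of powers of \<open>x\<close> and \<open>y\<close> span a stable module, on
  which \<open>x * y\<close> acts by the Kronecker product of the two matrices.\<close>

lemma algebraic_int_times:
  fixes x y :: complex
  assumes "algebraic_int x" "algebraic_int y"
  shows "algebraic_int (x * y)"
proof -
  obtain m c where m: "m > 0"
    "\<And>i. i < m \<Longrightarrow> x * x ^ i = (\<Sum>j<m. of_int (c i j) * x ^ j)"
    using algebraic_int_stable_powers[OF assms(1)] by metis
  obtain n d where n: "n > 0"
    "\<And>i. i < n \<Longrightarrow> y * y ^ i = (\<Sum>j<n. of_int (d i j) * y ^ j)"
    using algebraic_int_stable_powers[OF assms(2)] by metis
  show ?thesis
  proof (rule algebraic_int_if_stable_span[where I = "{..<m} \<times> {..<n}" and k = "(0, 0)"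
        and u = "\<lambda>(i, j). x ^ i * y ^ j" and a = "\<lambda>(i, j) (i', j'). c i i' * d j j'"])
    fix r assume "r \<in> {..<m} \<times> {..<n}"
    then obtain i j where r: "r = (i, j)" "i < m" "j < n" by auto
    have "x * y * (x ^ i * y ^ j) = (x * x ^ i) * (y * y ^ j)" by simp
    also have "\<dots> = (\<Sum>(i', j')\<in>{..<m} \<times> {..<n}.
        (of_int (c i i') * x ^ i') * (of_int (d j j') * y ^ j'))"
      unfolding m(2)[OF r(2)] n(2)[OF r(3)] sum_product sum.cartesian_product ..
    finally show "x * y * (case r of (i, j) \<Rightarrow> x ^ i * y ^ j) =
        (\<Sum>s\<in>{..<m} \<times> {..<n}. of_int ((case r of (i, j) \<Rightarrow> \<lambda>(i', j'). c i i' * d j j') s) *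
          (case s of (i, j) \<Rightarrow> x ^ i * y ^ j))"
      by (auto simp: r(1) case_prod_beta mult_ac)
  qed (use m(1) n(1) in auto)
qed

lemma algebraic_int_prod_list:
  fixes xs :: "complex list"
  assumes "\<forall>x\<in>set xs. algebraic_int x"
  shows "algebraic_int (prod_list xs)"
  using assms by (induction xs) (auto intro: algebraic_int_times int_imp_algebraic_int)

lemma algebraic_int_lead_coeff_times:
  fixes x :: complex
  assumes "poly (map_poly of_int P) x = 0"
  shows "algebraic_int (of_int (lead_coeff P) * x)"
proof (cases "degree P = 0")
  case True
  then obtain b where "P = [:b:]" by (rule degree_eq_zeroE)
  then show ?thesis using assms by (cases "b = 0") auto
next
  case False
  define n where "n = degree P"
  define L where "L = lead_coeff P"
  have n: "n > 0" using False by (simp add: n_def)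
  have L: "L \<noteq> 0" using False by (auto simp: L_def)
  \<comment> \<open>\<open>Q\<close> is monic and satisfies
    \<open>Q(L * X) = L ^ (n - 1) * P(X)\<close>.\<close>
  define Q where "Q = monom 1 n + (\<Sum>i<n. monom (coeff P i * L ^ (n - 1 - i)) i)"
  have cQ: "coeff Q i = (if i = n then 1 else if i < n then coeff P i * L ^ (n - 1 - i) else 0)" for i
    by (auto simp: Q_def coeff_sum)
  have dQ: "degree Q = n"
    by (rule antisym, rule degree_le) (auto simp: cQ intro: le_degree)
  have "poly (map_poly of_int Q) (of_int L * x) =
      (\<Sum>i\<le>n. of_int (coeff Q i) * (of_int L * x) ^ i)"
    by (simp add: poly_altdef coeff_map_poly dQ)
  also have "\<dots> = (\<Sum>i\<le>n. of_int L ^ (n - 1) * (of_int (coeff P i) * x ^ i))"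
  proof (rule sum.cong)
    fix i assume i: "i \<in> {..n}"
    show "of_int (coeff Q i) * (of_int L * x) ^ i = of_int L ^ (n - 1) * (of_int (coeff P i) * x ^ i)"
    proof (cases "i = n")
      case True
      have "(of_int L :: complex) ^ n = of_int L ^ (n - 1) * of_int L"
        using n by (metis Suc_diff_1 power_Suc2)
      then show ?thesis using True by (simp add: cQ power_mult_distrib n_def L_def)
    next
      case False
      then have "i < n" using i by simp
      then have "(of_int L :: complex) ^ (n - 1) = of_int L ^ (n - 1 - i) * of_int L ^ i"
        by (simp flip: power_add)
      then show ?thesis using \<open>i < n\<close> by (simp add: cQ power_mult_distrib)
    qed
  qed simp
  also have "\<dots> = of_int L ^ (n - 1) * poly (map_poly of_int P) x"
    by (simp add: poly_altdef coeff_map_poly n_def sum_distrib_left)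
  finally show ?thesis
    using assms dQ cQ[of n] unfolding algebraic_int_altdef_ipoly L_def by (intro exI[of _ Q]) simp
qed

text \<open>The reciprocal polynomial vanishes at \<open>1 / x\<close> and has leading coefficient
  \<open>coeff P 0\<close>.\<close>

lemma algebraic_int_coeff_0_divide:
  fixes x :: complex
  assumes "poly (map_poly of_int P) x = 0" "coeff P 0 \<noteq> 0" 
  shows "algebraic_int (of_int (coeff P 0) / x)"
proof -
  have x: "x \<noteq> 0" using assms by (auto simp: poly_0_coeff_0 coeff_map_poly)
  have "map_poly of_int (reflect_poly P) = reflect_poly (map_poly (of_int :: int \<Rightarrow> complex) P)"
    by (simp add: poly_eq_iff coeff_map_poly coeff_reflect_poly)
  then have "poly (map_poly of_int (reflect_poly P)) (inverse x) = 0"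
    using assms(1) x by (simp add: poly_reflect_poly_nz)
  then show ?thesis
    using algebraic_int_lead_coeff_times[of "reflect_poly P" "inverse x"] assms(2)
    by (simp add: divide_inverse coeff_reflect_poly)
qed

section \<open>Minimal polynomials and the Mahler measure\<close>

lemma int_poly_with_root_eq_0_iff_degree_0:
  fixes x :: complex and P :: "int poly"
  assumes "poly (map_poly of_int P) x = 0" "degree P = 0"
  shows "P = 0"
proof -
  obtain b where "P = [:b:]" using assms(2) by (rule degree_eq_zeroE)
  with assms(1) show ?thesis by (cases "b = 0") auto
qed

lemma poly_of_int_mult:
  "poly (map_poly of_int (P * Q)) x = poly (map_poly of_int P) x * poly (map_poly of_int Q) (x :: complex)"
  by (simp add: hom_distribs)

text \<open>
  Pseudo-division by an integer polynomial \<open>D\<close> of least degree vanishing at \<open>x\<close> avoids passing to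
  rational coefficients: \<open>D\<close> divides a constant multiple of both \<open>P\<close> and \<open>Q\<close>, and \<open>P\<close> is prime.
\<close>

lemma irreducible_int_poly_dvd_of_root:
  fixes x :: complex
  assumes P: "irreducible P" "poly (map_poly of_int P) x = 0"
    and Q: "poly (map_poly of_int Q) x = 0"
  shows "P dvd Q"
proof -
  have P0: "P \<noteq> 0" using P(1) by auto
  have prime: "prime_elem P" using P(1) by (simp add: irreducible_imp_prime_elem)
  define D where "D = (ARG_MIN degree D. D \<noteq> 0 \<and> poly (map_poly of_int D) x = 0)"
  have D: "D \<noteq> 0" "poly (map_poly of_int D) x = 0"
    and D_min: "\<And>R. R \<noteq> 0 \<Longrightarrow> poly (map_poly of_int R) x = 0 \<Longrightarrow> degree D \<le> degree R"
    using arg_min_nat_lemma[of "\<lambda>D. D \<noteq> 0 \<and> poly (map_poly of_int D) x = 0" P degree] P(2) P0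
    unfolding D_def by blast+
  have D_deg: "degree D > 0" using int_poly_with_root_eq_0_iff_degree_0[OF D(2)] D(1) by blast
  have D_dvd: "\<exists>a q. a \<noteq> 0 \<and> smult a R = D * q" if R: "poly (map_poly of_int R) x = 0" for R
  proof -
    from pseudo_mod(1)[OF D(1), of R] obtain a q
      where aq: "a \<noteq> 0" "smult a R = D * q + pseudo_mod R D" by blast
    have "pseudo_mod R D = smult a R - D * q" using aq(2) by simp
    then have "poly (map_poly of_int (pseudo_mod R D)) x = 0"
      using R D(2) by (simp add: hom_distribs)
    then have "pseudo_mod R D = 0"
      using D_min[of "pseudo_mod R D"] pseudo_mod(2)[OF D(1), of R] by fastforce
    with aq show ?thesis by auto
  qed
  have const: "\<not> P dvd [:b:]" if "b \<noteq> 0" for b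
  proof
    assume "P dvd [:b:]"
    then have "degree P \<le> 0" using dvd_imp_degree_le[of P "[:b:]"] that by simp
    then show False using int_poly_with_root_eq_0_iff_degree_0[OF P(2)] P0 by simp
  qed
  obtain a q where aq: "a \<noteq> 0" "smult a P = D * q" using D_dvd[OF P(2)] by blast
  have "\<not> P dvd q"
  proof
    assume "P dvd q"
    then obtain s where "q = P * s" ..
    then have "P * [:a:] = P * (D * s)" using aq(2) by (simp add: mult_ac)
    then have "[:a:] = D * s" using P0 by (metis mult_cancel_left)
    then have "D dvd [:a:]" by simp
    then have "degree D \<le> 0" using dvd_imp_degree_le[of D "[:a:]"] aq(1) by simp
    then show False using D_deg by simp
  qed
  moreover have "P dvd D * q" by (simp flip: aq(2) add: dvd_smult)
  ultimately have PD: "P dvd D" using prime by (simp add: prime_elem_dvd_mult_iff)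
  obtain b r where br: "b \<noteq> 0" "smult b Q = D * r" using D_dvd[OF Q] by blast
  have "P dvd [:b:] * Q" using PD br(2) by simp
  then show ?thesis using const[OF br(1)] prime prime_elem_dvd_mult_iff by blast
qed

text \<open>Two irreducible polynomials vanishing at \<alpha> divide each other, and a positive
  leading coefficient makes both normalized, so they are equal.\<close>

lemma min_poly_int_eqI:
  assumes "irreducible P" "lead_coeff P > 0" "poly (map_poly of_int P) \<alpha> = 0"
  shows "min_poly_int \<alpha> = P"
  unfolding min_poly_int_def
proof (rule the_equality)
  have norm: "normalize R = R" if "lead_coeff R > 0" for R :: "int poly"
    using that by (simp add: normalize_poly_def one_pCons[symmetric])
  fix Q assume Q: "irreducible Q \<and> lead_coeff Q > 0 \<and> poly (map_poly of_int Q) \<alpha> = 0"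
  then have "normalize Q = normalize P"
    using irreducible_int_poly_dvd_of_root assms by (intro associatedI) blast+
  then show "Q = P" using Q assms(2) norm by simp
qed (use assms in auto)

text \<open>Some prime factor of a nonzero integer polynomial vanishing at \<alpha> vanishes there
  too. Being normalized, it has positive leading coefficient.\<close>

lemma min_poly_int:
  assumes "algebraic \<alpha>"
  shows "irreducible (min_poly_int \<alpha>)" "lead_coeff (min_poly_int \<alpha>) > 0"
    "poly (map_poly of_int (min_poly_int \<alpha>)) \<alpha> = 0"
proof -
  obtain R where R: "poly (map_poly of_int R) \<alpha> = 0" "R \<noteq> 0"
    using assms by (elim algebraicE')
  have "R dvd prod_mset (prime_factorization R)"
    by (metis R(2) dvd_normalize_iff dvd_refl prod_mset_prime_factorization_weak)
  then have "poly (map_poly of_int (prod_mset (prime_factorization R))) \<alpha> = 0"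
    using R(1) by (auto simp: poly_of_int_mult elim!: dvdE)
  moreover have "\<exists>P\<in>#A. poly (map_poly of_int P) \<alpha> = 0"
    if "poly (map_poly of_int (prod_mset A)) \<alpha> = 0" for A :: "int poly multiset"
    using that by (induction A) (auto simp: poly_of_int_mult)
  ultimately obtain P where P: "P \<in># prime_factorization R" "poly (map_poly of_int P) \<alpha> = 0"
    by metis
  then have prime: "prime P" by auto
  have "P = normalize P" using prime by simp
  then have "unit_factor P = 1" using prime
    by (metis normalize_1 not_prime_0 unit_factor_normalize)
  then have "lead_coeff P > 0"
    by (simp add: unit_factor_poly_def one_pCons sgn_1_pos)
  moreover have "irreducible P" using prime by (simp add: prime_elem_imp_irreducible)
  ultimately have "min_poly_int \<alpha> = P" using P(2) by (intro min_poly_int_eqI)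
  then show "irreducible (min_poly_int \<alpha>)" "lead_coeff (min_poly_int \<alpha>) > 0"
    "poly (map_poly of_int (min_poly_int \<alpha>)) \<alpha> = 0"
    using P(2) \<open>lead_coeff P > 0\<close> \<open>irreducible P\<close> by auto
qed

lemma coeff_0_min_poly_int_nonzero:
  assumes "algebraic \<alpha>" "\<alpha> \<noteq> 0"
  shows "coeff (min_poly_int \<alpha>) 0 \<noteq> 0"
proof -
  obtain R where R: "coeff R 0 \<noteq> 0" "poly (map_poly of_int R) \<alpha> = 0"
    using assms by (elim algebraicE'_nonzero)
  then have "min_poly_int \<alpha> dvd R"
    using min_poly_int[OF assms(1)] irreducible_int_poly_dvd_of_root by blast
  then show ?thesis using R(1) by (auto simp: coeff_mult_0)
qed

lemma sum_mset_nonneg_real: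
  fixes f :: "'a \<Rightarrow> real"
  assumes "\<And>x. x \<in># A \<Longrightarrow> f x \<ge> 0"
  shows "(\<Sum>x\<in>#A. f x) \<ge> 0"
  using assms by (induction A) auto

lemma log_mahler_ge_ln_lead_coeff:
  "log_mahler \<alpha> \<ge> ln (real_of_int \<bar>lead_coeff (min_poly_int \<alpha>)\<bar>)"
  unfolding log_mahler_def by (simp add: sum_mset_nonneg_real)

text \<open>By Vieta, the constant coefficient is up to sign the leading coefficient times the
  product of the roots, and each \<open>cmod z\<close> is at most
  \<open>max 1 (cmod z)\<close>.\<close>

lemma log_mahler_ge_ln_coeff_0:
  assumes "algebraic \<alpha>" "\<alpha> \<noteq> 0"
  shows "log_mahler \<alpha> \<ge> ln (real_of_int \<bar>coeff (min_poly_int \<alpha>) 0\<bar>)"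
proof -
  define P where "P = (map_poly of_int (min_poly_int \<alpha>) :: complex poly)"
  have lead: "lead_coeff P = of_int (lead_coeff (min_poly_int \<alpha>))" by (simp add: P_def)
  have C0: "coeff (min_poly_int \<alpha>) 0 \<noteq> 0" using assms by (rule coeff_0_min_poly_int_nonzero)
  have L0: "lead_coeff (min_poly_int \<alpha>) > 0" using assms(1) by (rule min_poly_int)
  have eval: "poly (\<Prod>x\<in>#A. [:- x, 1:]) 0 = (\<Prod>x\<in>#A. - x)" for A :: "complex multiset"
    by (induction A) auto
  have "poly P 0 = poly (smult (lead_coeff P) (\<Prod>x\<in>#proots P. [:-x, 1:])) 0"
    by (simp only: complex_poly_decompose_multiset)
  then have prod: "of_int (coeff (min_poly_int \<alpha>) 0) = lead_coeff P * (\<Prod>x\<in>#proots P. - x)"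
    by (simp add: eval) (simp add: P_def poly_0_coeff_0)
  have nz: "x \<noteq> 0" if "x \<in># proots P" for x
  proof
    assume "x = 0"
    then have "(\<Prod>x\<in>#proots P. - x) = 0" using that
      by (metis image_mset_add_mset mset_add mult_eq_0_iff neg_equal_0_iff_equal prod_mset.add_mset)
    then show False using prod C0 by (metis mult_zero_right of_int_eq_0_iff)
  qed
  have ln_prod: "(\<Prod>x\<in>#A. - x) \<noteq> 0 \<and> ln (cmod (\<Prod>x\<in>#A. - x)) \<le> (\<Sum>z\<in>#A. ln (max 1 (cmod z)))"
    if "\<And>x. x \<in># A \<Longrightarrow> x \<noteq> 0" for A :: "complex multiset"
    using that
  proof (induction A)
    case (add x A)
    then have IH: "(\<Prod>x\<in>#A. - x) \<noteq> 0" "ln (cmod (\<Prod>x\<in>#A. - x)) \<le> (\<Sum>z\<in>#A. ln (max 1 (cmod z)))"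
      and "x \<noteq> 0" by auto
    then show ?case by (auto simp: norm_mult ln_mult intro!: add_mono)
  qed simp
  have "\<bar>real_of_int (coeff (min_poly_int \<alpha>) 0)\<bar> = cmod (of_int (coeff (min_poly_int \<alpha>) 0))"
    by simp
  also have "\<dots> = real_of_int (lead_coeff (min_poly_int \<alpha>)) * cmod (\<Prod>x\<in>#proots P. - x)"
    using L0 by (simp add: prod norm_mult lead)
  finally have "ln \<bar>real_of_int (coeff (min_poly_int \<alpha>) 0)\<bar> =
      ln (real_of_int (lead_coeff (min_poly_int \<alpha>))) + ln (cmod (\<Prod>x\<in>#proots P. - x))"
    using L0 ln_prod[of "proots P"] nz by (auto simp: ln_mult)
  also have "\<dots> \<le> log_mahler \<alpha>"
    using L0 ln_prod[of "proots P"] nz by (simp add: log_mahler_def P_def)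
  finally show ?thesis by simp
qed

text \<open>The minimal polynomial is \<open>b X - a\<close>: a constant factor divides both
  \<open>a\<close> and \<open>b\<close>, hence is a unit, and degree 1 leaves no other
  factorization.\<close>

lemma log_mahler_of_nat_divide:
  fixes a b :: nat
  assumes "coprime a b" "a > 0" "b > 0"
  shows "log_mahler (of_nat a / of_nat b) = ln (max (real a) (real b))"
proof -
  define P where "P = [:- int a, int b:]"
  have deg: "degree P = 1" using assms(3) by (simp add: P_def)
  have unit: "is_unit Q" if "degree Q = 0" "Q dvd P" for Q
  proof -
    obtain c where c: "Q = [:c:]" using \<open>degree Q = 0\<close> by (rule degree_eq_zeroE)
    with that(2) have "c dvd coeff P 0" "c dvd coeff P 1" by (auto simp: const_poly_dvd_iff)
    then have "c dvd int a" "c dvd int b" by (auto simp: P_def)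
    then have "is_unit c" using assms(1) coprime_common_divisor coprime_int_iff by blast
    then show ?thesis by (simp add: c is_unit_poly_iff)
  qed
  have "irreducible P"
  proof (rule irreducibleI)
    show "P \<noteq> 0" using deg by auto
    show "\<not> is_unit P" using deg by (auto simp: is_unit_poly_iff)
    fix Q R assume QR: "P = Q * R"
    then have "degree P = degree Q + degree R"
      using \<open>P \<noteq> 0\<close> by (metis degree_mult_eq mult_zero_left mult_zero_right)
    then have "degree Q = 0 \<or> degree R = 0" using deg by linarith
    then show "is_unit Q \<or> is_unit R" using unit QR by auto
  qed
  moreover have "poly (map_poly of_int P) (of_nat a / of_nat b :: complex) = 0"
    using assms(3) by (simp add: P_def)
  ultimately have mp: "min_poly_int (of_nat a / of_nat b) = P"
    using assms(3) by (intro min_poly_int_eqI) (auto simp: P_def)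
  have "map_poly of_int P = smult (of_nat b) [:- (of_nat a / of_nat b), 1 :: complex:]"
    using assms(3) by (simp add: P_def)
  then have "proots (map_poly of_int P) = {# of_nat a / of_nat b :: complex #}"
    using assms(3) by (simp only: proots_smult of_nat_eq_0_iff proots_linear_factor) simp
  then have "log_mahler (of_nat a / of_nat b) = ln (real b) + ln (max 1 (real a / real b))"
    using assms(3) deg by (simp add: log_mahler_def mp norm_divide) (simp add: P_def)
  also have "\<dots> = ln (real b * max 1 (real a / real b))"
    using assms by (subst ln_mult) (auto simp: less_max_iff_disj)
  also have "real b * max 1 (real a / real b) = max (real a) (real b)"
    using assms by (auto simp: max_def field_simps)
  finally show ?thesis .
qed

lemma algebraic_of_nat_divide: "algebraic (of_nat a / of_nat b :: complex)"
  by (metis Rats_divide Rats_of_nat rat_imp_algebraic)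

section \<open>Exponents of the two primes in a product representation\<close>

text \<open>The product of all \<open>f b * g b\<close> is a rational algebraic integer, hence an
  integer; as \<open>q\<close> does not divide \<open>a\<close>, the power \<open>q ^ k\<close>
  divides the product of the \<open>f b\<close>. It serves for leading coefficients with \<beta> and
  for constant coefficients with \<open>inverse \<beta>\<close>.\<close>

lemma prime_power_le_sum_multiplicity:
  fixes f :: "'b \<Rightarrow> int" and g :: "'b \<Rightarrow> complex"
  assumes q: "prime q" "\<not> q dvd a"
    and fg: "\<forall>b\<in>set bs. f b \<noteq> 0 \<and> algebraic_int (of_int (f b) * g b)"
    and prod: "prod_list (map g bs) = of_nat a / of_nat q ^ k"
  shows "k \<le> (\<Sum>b\<leftarrow>bs. multiplicity (int q) (f b))"
proof -
  define F where "F = prod_list (map f bs)"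
  have F: "F \<noteq> 0" and mult: "multiplicity (int q) F = (\<Sum>b\<leftarrow>bs. multiplicity (int q) (f b))"
    using fg unfolding F_def
    by (induction bs) (use q(1) in \<open>auto simp: prime_elem_multiplicity_mult_distrib\<close>)
  define x where "x = (of_int F * (of_nat a / of_nat q ^ k) :: complex)"
  have "x = prod_list (map (\<lambda>b. of_int (f b) * g b) bs)"
    unfolding x_def F_def prod[symmetric] by (induction bs) auto
  then have "algebraic_int x"
    using fg algebraic_int_prod_list[of "map (\<lambda>b. of_int (f b) * g b) bs"] by simp
  moreover have "x \<in> \<rat>" by (simp add: x_def)
  ultimately obtain m where "x = of_int m"
    by (meson Ints_cases rational_algebraic_int_is_int)
  then have "(of_int (F * int a) :: complex) = of_int (m * int q ^ k)"
    using q(1) by (simp add: x_def field_simps prime_gt_0_nat)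
  then have "F * int a = m * int q ^ k" by (simp only: of_int_eq_iff)
  then have "int q ^ k dvd F * int a" by simp
  moreover have "coprime (int q ^ k) (int a)"
    using q by (simp add: prime_imp_coprime)
  ultimately have "int q ^ k dvd F" by (simp add: coprime_dvd_mult_left_iff)
  then have "k \<le> multiplicity (int q) F"
    using q(1) F by (intro multiplicity_geI) auto
  then show ?thesis by (simp only: mult)
qed

lemma multiplicity_times_ln_le:
  fixes x :: int
  assumes "prime p" "x \<noteq> 0"
  shows "real (multiplicity (int p) x) * ln (real p) \<le> ln (real_of_int \<bar>x\<bar>)"
proof -
  have "int p ^ multiplicity (int p) x dvd x" by (rule multiplicity_dvd)
  then have "int p ^ multiplicity (int p) x \<le> \<bar>x\<bar>" using assms(2) by (metis dvd_imp_le_int abs_of_nonneg of_nat_0_le_iff of_nat_power)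
  then have "real_of_int (int p ^ multiplicity (int p) x) \<le> real_of_int \<bar>x\<bar>" by (simp only: of_int_le_iff)
  then have "real p ^ multiplicity (int p) x \<le> real_of_int \<bar>x\<bar>" by simp
  then have "ln (real p ^ multiplicity (int p) x) \<le> ln (real_of_int \<bar>x\<bar>)"
    using assms by (subst ln_le_cancel_iff) (auto simp: prime_gt_0_nat)
  then show ?thesis using assms(1) by (simp add: ln_realpow prime_gt_0_nat)
qed

text \<open>For distinct primes, the number \<open>p ^ a / q ^ b\<close> gets the pair
  \<open>(a, b)\<close>.\<close>

definition factor_exponents :: "nat \<Rightarrow> nat \<Rightarrow> complex \<Rightarrow> nat \<times> nat" where
  "factor_exponents p q \<beta> =
     (multiplicity (int p) (coeff (min_poly_int \<beta>) 0),
      multiplicity (int q) (lead_coeff (min_poly_int \<beta>)))"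

lemma factor_exponents_le_log_mahler:
  assumes "prime p" "prime q" "algebraic \<beta>" "\<beta> \<noteq> 0" "factor_exponents p q \<beta> = (a, b)"
  shows "max (real a * ln (real p)) (real b * ln (real q)) \<le> log_mahler \<beta>"
proof -
  have "lead_coeff (min_poly_int \<beta>) \<noteq> 0" "coeff (min_poly_int \<beta>) 0 \<noteq> 0"
    using min_poly_int(2)[OF assms(3)] coeff_0_min_poly_int_nonzero[OF assms(3,4)] by auto
  then have "real b * ln (real q) \<le> log_mahler \<beta>" "real a * ln (real p) \<le> log_mahler \<beta>"
    using assms order_trans[OF multiplicity_times_ln_le log_mahler_ge_ln_lead_coeff]
      order_trans[OF multiplicity_times_ln_le log_mahler_ge_ln_coeff_0]
    by (auto simp: factor_exponents_def)
  then show ?thesis by simp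
qed

lemma sum_factor_exponents_ge:
  assumes pq: "prime p" "prime q" "p \<noteq> q"
    and \<beta>s: "\<beta>s \<in> product_representations (of_nat p ^ h / of_nat q ^ k)"
  shows "h \<le> (\<Sum>\<beta>\<leftarrow>\<beta>s. fst (factor_exponents p q \<beta>))"
    and "k \<le> (\<Sum>\<beta>\<leftarrow>\<beta>s. snd (factor_exponents p q \<beta>))"
proof -
  have alg: "algebraic \<beta>" "\<beta> \<noteq> 0" if "\<beta> \<in> set \<beta>s" for \<beta>
    using that \<beta>s by (auto simp: product_representations_def)
  have prod: "prod_list \<beta>s = of_nat p ^ h / of_nat q ^ k"
    using \<beta>s by (simp add: product_representations_def)
  have ndvd: "\<not> q dvd p ^ h" "\<not> p dvd q ^ k"
    using pq by (metis prime_dvd_power primes_dvd_imp_eq)+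
  have "k \<le> (\<Sum>\<beta>\<leftarrow>\<beta>s. multiplicity (int q) (lead_coeff (min_poly_int \<beta>)))"
  proof (rule prime_power_le_sum_multiplicity[OF pq(2) ndvd(1)])
    show "\<forall>\<beta>\<in>set \<beta>s. lead_coeff (min_poly_int \<beta>) \<noteq> 0 \<and>
        algebraic_int (of_int (lead_coeff (min_poly_int \<beta>)) * \<beta>)"
    proof
      fix \<beta> assume "\<beta> \<in> set \<beta>s"
      then show "lead_coeff (min_poly_int \<beta>) \<noteq> 0 \<and>
          algebraic_int (of_int (lead_coeff (min_poly_int \<beta>)) * \<beta>)"
        using min_poly_int[OF alg(1)] algebraic_int_lead_coeff_times[of "min_poly_int \<beta>" \<beta>]
        by (metis less_irrefl)
    qed
  qed (simp add: prod)
  then show "k \<le> (\<Sum>\<beta>\<leftarrow>\<beta>s. snd (factor_exponents p q \<beta>))" by (simp add: factor_exponents_def)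
  have "h \<le> (\<Sum>\<beta>\<leftarrow>\<beta>s. multiplicity (int p) (coeff (min_poly_int \<beta>) 0))"
  proof (rule prime_power_le_sum_multiplicity[OF pq(1) ndvd(2), where g = inverse])
    show "\<forall>\<beta>\<in>set \<beta>s. coeff (min_poly_int \<beta>) 0 \<noteq> 0 \<and>
        algebraic_int (of_int (coeff (min_poly_int \<beta>) 0) * inverse \<beta>)"
      using min_poly_int(3) coeff_0_min_poly_int_nonzero algebraic_int_coeff_0_divide alg
      by (auto simp: divide_inverse)
    have "prod_list (map inverse \<beta>s) = inverse (prod_list \<beta>s)"
      by (induction \<beta>s) auto
    then show "prod_list (map inverse \<beta>s) = of_nat (q ^ k) / of_nat p ^ h"
      by (simp add: prod)
  qed
  then show "h \<le> (\<Sum>\<beta>\<leftarrow>\<beta>s. fst (factor_exponents p q \<beta>))" by (simp add: factor_exponents_def)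
qed

section \<open>Optimal sums of pairs of naturals\<close>

text \<open>The value at 0 corresponds to the convention \<open>h\<^sub>-\<^sub>1 = 1\<close>.\<close>

fun fib_vec :: "nat \<Rightarrow> nat \<times> nat" where
  "fib_vec 0 = (0, 1)"
| "fib_vec (Suc k) = (fib (Suc k), fib k)"

lemma fib_vec_Suc_Suc: "fib_vec (Suc (Suc k)) = fib_vec (Suc k) + fib_vec k"
  by (cases k) auto

lemma fib_vec_pos: "i \<ge> 1 \<Longrightarrow> fib_vec i = (fib i, fib (i - 1))"
  by (cases i) auto

lemma fst_sum_mset: "fst (\<Sum>x\<in>#M. f x) = (\<Sum>x\<in>#M. fst (f x))"
  by (induction M) auto

lemma snd_sum_mset: "snd (\<Sum>x\<in>#M. f x) = (\<Sum>x\<in>#M. snd (f x))"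
  by (induction M) auto

lemma fib_vec_nonzero: "fib_vec i \<noteq> 0"
  using fib_neq_0_nat[of i] by (cases i) (auto simp: zero_prod_def)

lemma sum_mset_fib_vec_nonzero:
  assumes "M \<noteq> {#}"
  shows "(\<Sum>i\<in>#M. fib_vec i) \<noteq> 0"
proof
  assume sum: "(\<Sum>i\<in>#M. fib_vec i) = 0"
  obtain i M' where "M = add_mset i M'" using assms by (cases M) auto
  then have "fib_vec i = 0" using sum by (auto simp: prod_eq_iff)
  then show False using fib_vec_nonzero by blast
qed

text \<open>
  Euclid's algorithm on the coordinates: writing \<open>w\<close> for \<open>fib_vec\<close>, the cone of \<open>w k\<close> and \<open>w (k + 1)\<close> is
  the union of those of \<open>w k\<close>, \<open>w (k + 2)\<close>, where the parities agree, and of \<open>w (k + 1)\<close>,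
  \<open>w (k + 2)\<close>, where one continues. Once \<open>k + 1 = N\<close>, the bound on
  \<open>fst v\<close> leaves at most one nonzero coordinate.
\<close>

lemma fib_vec_cone_decomposition:
  assumes "v = (\<Sum>i\<in>#replicate_mset x k + replicate_mset y (Suc k). fib_vec i)"
    and "k < N" "N \<ge> 2" "fst v \<le> fib N"
  shows "\<exists>M b. set_mset M \<subseteq> {..N} \<and> (\<forall>i\<in>#M. odd i = b) \<and> v = (\<Sum>i\<in>#M. fib_vec i)"
  using assms
proof (induction "N - k" arbitrary: k x y rule: less_induct)
  case less
  consider "Suc k = N" | "Suc k < N" "x \<le> y" | "Suc k < N" "y < x" using less.prems by linarith
  then show ?case
  proof cases
    case 1
    consider "x = 0" | "y = 0" | "x > 0" "y > 0" by linarith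
    then show ?thesis
    proof cases
      case 1
      then show ?thesis using less.prems \<open>Suc k = N\<close>
        by (intro exI[of _ "replicate_mset y (Suc k)"]) (auto simp del: fib_vec.simps)
    next
      case 2
      then show ?thesis using less.prems
        by (intro exI[of _ "replicate_mset x k"]) (auto simp del: fib_vec.simps)
    next
      case 3
      then obtain x' y' where "x = Suc x'" "y = Suc y'" by (metis gr0_implies_Suc)
      then have "fst (fib_vec (Suc k) + fib_vec k) \<le> fst v"
        using less.prems(1) by (simp del: fib_vec.simps)
      moreover have "fib N < fst (fib_vec (Suc k) + fib_vec k)"
        using 1 less.prems(3) fib_neq_0_nat[of k] by (cases k) auto
      ultimately show ?thesis using less.prems(4) by linarith
    qed
  next
    case 2
    have "v = (\<Sum>i\<in>#replicate_mset (y - x) (Suc k) + replicate_mset x (Suc (Suc k)). fib_vec i)"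
    proof -
      have "(\<Sum>i\<in>#replicate_mset x (Suc (Suc k)). fib_vec i) =
          (\<Sum>i\<in>#replicate_mset x (Suc k). fib_vec i) + (\<Sum>i\<in>#replicate_mset x k. fib_vec i)"
        by (induction x) (simp_all del: fib_vec.simps add: fib_vec_Suc_Suc add_ac)
      moreover have "replicate_mset y (Suc k) = replicate_mset (y - x) (Suc k) + replicate_mset x (Suc k)"
        using 2 by (simp add: multiset_eq_iff)
      ultimately show ?thesis using less.prems(1) by (simp del: fib_vec.simps add: add_ac)
    qed
    then show ?thesis using less.hyps[of "Suc k" "y - x" x] less.prems 2 by auto
  next
    case 3
    have "(\<Sum>i\<in>#replicate_mset y (Suc (Suc k)). fib_vec i) =
        (\<Sum>i\<in>#replicate_mset y (Suc k). fib_vec i) + (\<Sum>i\<in>#replicate_mset y k. fib_vec i)"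
      by (induction y) (simp_all del: fib_vec.simps add: fib_vec_Suc_Suc add_ac)
    moreover have "replicate_mset x k = replicate_mset (x - y) k + replicate_mset y k"
      using 3 by (simp add: multiset_eq_iff)
    ultimately have "v = (\<Sum>i\<in>#replicate_mset (x - y) k + replicate_mset y (Suc (Suc k)). fib_vec i)"
      using less.prems(1) by (simp del: fib_vec.simps add: add_ac)
    then show ?thesis using 3
      by (intro exI[of _ "replicate_mset (x - y) k + replicate_mset y (Suc (Suc k))"] exI[of _ "odd k"])
        (auto simp del: fib_vec.simps split: if_splits)
  qed
qed

text \<open>Since \<open>fib_vec 1 = (1, 0)\<close> and \<open>fib_vec 0 = (0, 1)\<close>, the
  coordinates of \<open>v\<close> themselves start the algorithm.\<close>

lemma fib_vec_same_parity_decomposition: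
  assumes "N \<ge> 2" "fst v \<le> fib N"
  obtains M b where "set_mset M \<subseteq> {..N}" "\<And>i. i \<in># M \<Longrightarrow> odd i = b" "v = (\<Sum>i\<in>#M. fib_vec i)"
proof -
  have "v = (\<Sum>i\<in>#replicate_mset (snd v) 0 + replicate_mset (fst v) (Suc 0). fib_vec i)"
    unfolding prod_eq_iff fst_sum_mset snd_sum_mset by simp
  from fib_vec_cone_decomposition[OF this, of N] assms
  obtain M b where "set_mset M \<subseteq> {..N}" "\<forall>i\<in>#M. odd i = b" "v = (\<Sum>i\<in>#M. fib_vec i)"
    by auto
  then show ?thesis by (intro that) auto
qed

text \<open>Write \<open>(a + b) powr t\<close> as \<open>(a + b) * (a + b) powr (t - 1)\<close>;
  the power with exponent \<open>t - 1 \<le> 0\<close> is antitone.\<close>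

lemma powr_add_le:
  fixes a b t :: real
  assumes "a \<ge> 0" "b \<ge> 0" "0 < t" "t \<le> 1"
  shows "(a + b) powr t \<le> a powr t + b powr t"
proof (cases "a = 0 \<or> b = 0")
  case False
  then have pos: "a > 0" "b > 0" using assms by auto
  have "(a + b) powr t = (a + b) * (a + b) powr (t - 1)"
    using pos by (simp add: powr_diff)
  also have "\<dots> = a * (a + b) powr (t - 1) + b * (a + b) powr (t - 1)" by (simp add: algebra_simps)
  also have "\<dots> \<le> a * a powr (t - 1) + b * b powr (t - 1)"
    using pos assms by (intro add_mono mult_left_mono powr_mono2') auto
  also have "\<dots> = a powr t + b powr t" using pos by (simp add: powr_diff)
  finally show ?thesis .
qed auto

text \<open>The same factorization, now with a positive exponent \<open>t - 1\<close>, for which the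
  power is strictly increasing.\<close>

lemma powr_add_less:
  fixes a b t :: real
  assumes "a > 0" "b > 0" "t > 1"
  shows "a powr t + b powr t < (a + b) powr t"
proof -
  have "a powr t + b powr t = a * a powr (t - 1) + b * b powr (t - 1)"
    using assms by (simp add: powr_diff)
  also have "\<dots> < a * (a + b) powr (t - 1) + b * (a + b) powr (t - 1)"
    using assms by (intro add_strict_mono mult_strict_left_mono powr_less_mono2) auto
  also have "\<dots> = (a + b) * (a + b) powr (t - 1)" by (simp add: algebra_simps)
  also have "\<dots> = (a + b) powr t" using assms by (simp add: powr_diff)
  finally show ?thesis .
qed

section \<open>Splittings of a pair into nonzero pairs\<close>

text \<open>
  The zero pair costs nothing, so it has to be excluded for \<open>splittings T\<close> to be finite.
\<close>

definition splittings :: "nat \<times> nat \<Rightarrow> (nat \<times> nat) multiset set" where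
  "splittings T = {F. sum_mset F = T \<and> 0 \<notin># F}"

text \<open>
  Breaks ties between splittings of equal cost: merging decreases it, and so does replacing
  \<open>(0, 1) + (a, b)\<close> by \<open>(1, 1) + (a - 1, b)\<close> when \<open>a > b\<close>. The subtraction is truncated.
\<close>

definition size_excess :: "(nat \<times> nat) multiset \<Rightarrow> nat" where
  "size_excess F = size F + (\<Sum>v\<in>#F. snd v - fst v)"

lemma size_excess_union [simp]: "size_excess (F + G) = size_excess F + size_excess G"
  by (simp add: size_excess_def)

lemma splittings_le:
  assumes "F \<in> splittings T" "v \<in># F"
  shows "fst v \<le> fst T" "snd v \<le> snd T"
proof -
  obtain G where "F = add_mset v G" using assms(2) by (rule mset_add)
  then have "T = v + sum_mset G" using assms(1) by (simp add: splittings_def)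
  then show "fst v \<le> fst T" "snd v \<le> snd T" by auto
qed

text \<open>Each nonzero part adds at least 1 to the sum of the coordinates, which bounds the number
  of parts.\<close>

lemma finite_splittings: "finite (splittings T)"
proof -
  have size: "size F \<le> fst (sum_mset F) + snd (sum_mset F)" if "0 \<notin># F" for F :: "(nat \<times> nat) multiset"
    using that
  proof (induction F)
    case (add v F)
    then have "v \<noteq> 0" by auto
    then have "fst v + snd v \<ge> 1" by (cases v) (auto simp: zero_prod_def)
    then show ?case using add by auto
  qed simp
  let ?S = "{..fst T} \<times> {..snd T}"
  have "splittings T \<subseteq> mset ` {xs. set xs \<subseteq> ?S \<and> length xs \<le> fst T + snd T}"
  proof
    fix F assume F: "F \<in> splittings T"
    obtain xs where xs: "mset xs = F" using ex_mset by blast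
    have "set xs \<subseteq> ?S"
    proof
      fix v assume "v \<in> set xs"
      then have "v \<in># F" using xs by auto
      then show "v \<in> ?S" using splittings_le[OF F, of v] by (cases v) auto
    qed
    moreover have "length xs \<le> fst T + snd T"
      using size[of F] F xs by (auto simp: splittings_def)
    ultimately show "F \<in> mset ` {xs. set xs \<subseteq> ?S \<and> length xs \<le> fst T + snd T}" using xs by blast
  qed
  moreover have "finite {xs. set xs \<subseteq> ?S \<and> length xs \<le> fst T + snd T}"
    by (intro finite_lists_length_le) auto
  ultimately show ?thesis by (meson finite_imageI finite_subset)
qed

section \<open>Weights with alternating signs\<close>

text \<open>\<open>P\<close> and \<open>Q\<close> stand for the logarithms of \<open>p\<close> and
  \<open>q\<close>. The sign conditions, which (W) provides, say that the weight of
  \<open>fib_vec i\<close> is given by its first coordinate for odd \<open>i\<close> and by its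
  second for even \<open>i\<close>.\<close>

locale fib_weights =
  fixes N :: nat and P Q :: real
  assumes N_ge_2: "N \<ge> 2" and P_pos: "P > 0"
    and sign_odd: "\<And>i. i \<le> N \<Longrightarrow> odd i \<Longrightarrow> real (snd (fib_vec i)) * Q < real (fst (fib_vec i)) * P"
    and sign_even: "\<And>i. i \<le> N \<Longrightarrow> even i \<Longrightarrow> real (fst (fib_vec i)) * P < real (snd (fib_vec i)) * Q"
begin

lemma P_less_Q: "P < Q"
  using sign_even[of 2] N_ge_2 by (simp add: numeral_2_eq_2)

lemma Q_pos: "Q > 0"
  using P_less_Q P_pos by linarith

text \<open>When \<open>P\<close> and \<open>Q\<close> are the logarithms of distinct primes
  \<open>p\<close> and \<open>q\<close>, this is the logarithmic Mahler measure of
  \<open>p ^ a / q ^ b\<close> for \<open>v = (a, b)\<close>.\<close>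

definition wt :: "nat \<times> nat \<Rightarrow> real" where
  "wt v = max (real (fst v) * P) (real (snd v) * Q)"

definition cost :: "real \<Rightarrow> (nat \<times> nat) multiset \<Rightarrow> real" where
  "cost t F = (\<Sum>v\<in>#F. wt v powr t)"

lemma cost_union [simp]: "cost t (F + G) = cost t F + cost t G"
  by (simp add: cost_def)

lemma wt_nonneg: "wt v \<ge> 0"
  using P_pos by (auto simp: wt_def le_max_iff_disj)

lemma wt_pos: "v \<noteq> 0 \<Longrightarrow> wt v > 0"
  using P_pos Q_pos by (cases v) (auto simp: wt_def less_max_iff_disj zero_prod_def)

lemma wt_add_le: "wt (u + v) \<le> wt u + wt v"
  by (auto simp: wt_def distrib_right intro!: add_mono)

text \<open>The sign inequalities of the summands point the same way and add up, so the same
  coordinate attains every maximum. Hence \<open>wt\<close> is additive on such sums.\<close>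

lemma wt_sum_mset_same_parity:
  assumes "set_mset M \<subseteq> {..N}" "\<And>i. i \<in># M \<Longrightarrow> odd i = b"
  shows "wt (\<Sum>i\<in>#M. fib_vec i) =
    (if b then real (fst (\<Sum>i\<in>#M. fib_vec i)) * P else real (snd (\<Sum>i\<in>#M. fib_vec i)) * Q)"
proof -
  have "if b then real (snd (\<Sum>i\<in>#M. fib_vec i)) * Q \<le> real (fst (\<Sum>i\<in>#M. fib_vec i)) * P
      else real (fst (\<Sum>i\<in>#M. fib_vec i)) * P \<le> real (snd (\<Sum>i\<in>#M. fib_vec i)) * Q"
    using assms
  proof (induction M)
    case (add i M)
    then have i: "i \<le> N" "odd i = b" by auto
    then show ?case using sign_odd[of i] sign_even[of i] add
      by (auto simp: distrib_right simp del: fib_vec.simps split: if_splits)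
  qed simp
  then show ?thesis by (auto simp: wt_def)
qed

text \<open>Both \<open>wt\<close> and, for \<open>t \<le> 1\<close>, the power are subadditive, so
  merging all parts never raises the cost.\<close>

lemma wt_sum_mset_ge: "0 < t \<Longrightarrow> t \<le> 1 \<Longrightarrow> wt (sum_mset F) powr t \<le> cost t F"
proof (induction F)
  case (add v F)
  have "wt (v + sum_mset F) powr t \<le> (wt v + wt (sum_mset F)) powr t"
    using add.prems wt_nonneg by (intro powr_mono2 wt_add_le) auto
  also have "\<dots> \<le> wt v powr t + wt (sum_mset F) powr t"
    using add.prems wt_nonneg by (intro powr_add_le) auto
  finally show ?case using add by (simp add: cost_def)
qed (simp add: cost_def wt_def)

section \<open>Exchange arguments for optimal splittings\<close>

definition lex_optimal :: "real \<Rightarrow> nat \<times> nat \<Rightarrow> (nat \<times> nat) multiset \<Rightarrow> bool" where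
  "lex_optimal t T F \<longleftrightarrow> F \<in> splittings T \<and>
     (\<forall>G\<in>splittings T. cost t F \<le> cost t G \<and> (cost t G \<le> cost t F \<longrightarrow> size_excess F \<le> size_excess G))"

lemma lex_optimal_exists:
  assumes "F0 \<in> splittings T"
  shows "\<exists>F. lex_optimal t T F"
proof -
  define c where "c = Min (cost t ` splittings T)"
  have fin: "finite (cost t ` splittings T)" by (intro finite_imageI finite_splittings)
  then have "c \<in> cost t ` splittings T" unfolding c_def using assms by (intro Min_in) auto
  then obtain F1 where F1: "F1 \<in> splittings T" "cost t F1 = c" by auto
  have c_le: "c \<le> cost t G" if "G \<in> splittings T" for G
    unfolding c_def using that by (intro Min_le fin) auto
  obtain F where F: "F \<in> splittings T \<and> cost t F = c"
    "\<And>G. G \<in> splittings T \<and> cost t G = c \<Longrightarrow> size_excess F \<le> size_excess G"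
    using ex_has_least_nat[of "\<lambda>F. F \<in> splittings T \<and> cost t F = c" F1 size_excess] F1 by blast
  then show ?thesis using c_le unfolding lex_optimal_def by (metis order_antisym)
qed

text \<open>Exchanging the part \<open>Y\<close> of \<open>F\<close> for \<open>Y'\<close> gives
  another splitting of \<open>T\<close>, and the common remainder cancels in \<open>cost\<close> and
  \<open>size_excess\<close>.\<close>

lemma lex_optimal_exchange:
  assumes "lex_optimal t T F" "Y \<subseteq># F" "sum_mset Y' = sum_mset Y" "0 \<notin># Y'"
  shows "cost t Y \<le> cost t Y'" "cost t Y' \<le> cost t Y \<Longrightarrow> size_excess Y \<le> size_excess Y'"
proof -
  obtain X where X: "F = Y + X" using assms(2) by (auto simp: mset_subset_eq_exists_conv)
  have "Y' + X \<in> splittings T"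
    using assms by (auto simp: X lex_optimal_def splittings_def)
  then show "cost t Y \<le> cost t Y'" "cost t Y' \<le> cost t Y \<Longrightarrow> size_excess Y \<le> size_excess Y'"
    using assms(1) X by (auto simp: lex_optimal_def)
qed

text \<open>If \<open>v\<close> were a sum of several Fibonacci vectors of one parity, splitting one
  off would keep the total weight and, by strict superadditivity for \<open>t > 1\<close>, lower the
  cost.\<close>

lemma lex_optimal_fib_vec:
  assumes opt: "lex_optimal t T F" and t: "t > 1" and T: "fst T \<le> fib N" and v: "v \<in># F"
  shows "\<exists>i\<le>N. v = fib_vec i"
proof -
  have F: "F \<in> splittings T" using opt by (simp add: lex_optimal_def)
  have "fst v \<le> fib N" using splittings_le(1)[OF F v] T by simp
  then obtain M b where M: "set_mset M \<subseteq> {..N}" "\<And>i. i \<in># M \<Longrightarrow> odd i = b" "v = (\<Sum>i\<in>#M. fib_vec i)"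
    using fib_vec_same_parity_decomposition[OF N_ge_2] by metis
  have "v \<noteq> 0" using F v by (auto simp: splittings_def)
  then obtain i M' where M': "M = add_mset i M'" using M(3) by (cases M) auto
  show ?thesis
  proof (cases "M' = {#}")
    case True
    then show ?thesis using M M' by auto
  next
    case False
    define u where "u = (\<Sum>i\<in>#M'. fib_vec i)"
    have u: "u \<noteq> 0" using sum_mset_fib_vec_nonzero[OF False] by (simp add: u_def)
    have vu: "v = fib_vec i + u" using M(3) M' by (simp add: u_def del: fib_vec.simps)
    have "wt v = wt (fib_vec i) + wt u"
      using wt_sum_mset_same_parity[of M b] wt_sum_mset_same_parity[of M' b]
        wt_sum_mset_same_parity[of "{#i#}" b] M M'
      by (auto simp: u_def distrib_right simp del: fib_vec.simps)
    then have "wt (fib_vec i) powr t + wt u powr t < wt v powr t"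
      using powr_add_less[OF wt_pos wt_pos, of "fib_vec i" u t] fib_vec_nonzero u t by simp
    moreover have "cost t {#v#} \<le> cost t {#fib_vec i, u#}"
      using opt by (rule lex_optimal_exchange) (use v vu u fib_vec_nonzero[of i] in auto)
    ultimately show ?thesis by (simp add: cost_def)
  qed
qed

text \<open>Some part \<open>(a, b)\<close> with \<open>b < a\<close> has to compensate for
  \<open>(0, 1)\<close>. Moving a unit of the first coordinate over does not raise the cost, because
  \<open>P < Q\<close> gives \<open>(1, 1)\<close> the weight of \<open>(0, 1)\<close>, but it
  lowers \<open>size_excess\<close>.\<close>

lemma lex_optimal_no_fib_vec_0:
  assumes opt: "lex_optimal t T F" and t: "t > 1" and T: "snd T \<le> fst T"
  shows "fib_vec 0 \<notin># F"
proof
  assume "fib_vec 0 \<in># F"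
  then obtain F' where F': "F = add_mset (0, 1) F'" by (auto elim: mset_add)
  have sum: "T = sum_mset F" using opt by (simp add: lex_optimal_def splittings_def)
  have "\<exists>u\<in>#F'. snd u < fst u"
  proof (rule ccontr)
    assume "\<not> ?thesis"
    then have "\<forall>u\<in>#F'. fst u \<le> snd u" by (meson not_le)
    then have "fst (sum_mset F') \<le> snd (sum_mset F')" by (induction F') auto
    then show False using T by (simp add: sum F')
  qed
  then obtain a b where u: "(a, b) \<in># F'" "b < a" by auto
  then have Y: "{#(0, 1), (a, b)#} \<subseteq># F" by (simp add: F')
  have wt_le: "wt (1, 1) \<le> wt (0, 1)" "wt (a - 1, b) \<le> wt (a, b)"
    using P_pos Q_pos P_less_Q u(2) by (auto simp: wt_def max_def field_simps)
  have powr_le: "wt (1, 1) powr t \<le> wt (0, 1) powr t" "wt (a - 1, b) powr t \<le> wt (a, b) powr t"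
    using t wt_le wt_nonneg by (auto intro!: powr_mono2)
  show False
  proof (cases "(a - 1, b) = 0")
    \<comment> \<open>Here \<open>(a, b) = (1, 0)\<close>, and the move merges both parts into
      one.\<close>
    case True
    then have "sum_mset {#(1, 1)#} = sum_mset {#(0, 1), (a, b)#}"
      using u(2) by (auto simp: zero_prod_def)
    moreover have "0 \<notin># {#(1, 1) :: nat \<times> nat#}" by (simp add: zero_prod_def)
    moreover have "cost t {#(1, 1)#} \<le> cost t {#(0, 1), (a, b)#}"
      using powr_le(1) by (simp add: cost_def add_increasing2)
    ultimately have "size_excess {#(0, 1), (a, b)#} \<le> size_excess {#(1, 1)#}"
      using lex_optimal_exchange(2)[OF opt Y] by blast
    then show False by (simp add: size_excess_def)
  next
    case False
    have "sum_mset {#(1, 1), (a - 1, b)#} = sum_mset {#(0, 1), (a, b)#}"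
      using u(2) by auto
    moreover have "0 \<notin># {#(1, 1), (a - 1, b)#}" using False by (auto simp: zero_prod_def)
    moreover have "cost t {#(1, 1), (a - 1, b)#} \<le> cost t {#(0, 1), (a, b)#}"
      using powr_le by (simp add: cost_def)
    ultimately have "size_excess {#(0, 1), (a, b)#} \<le> size_excess {#(1, 1), (a - 1, b)#}"
      using lex_optimal_exchange(2)[OF opt Y] by blast
    then show False using u(2) by (simp add: size_excess_def)
  qed
qed

definition vec_cost :: "real \<Rightarrow> (nat \<Rightarrow> nat) \<Rightarrow> real" where
  "vec_cost t z = (\<Sum>i=1..N. real (z i) * wt (fib_vec i) powr t)"

text \<open>For \<open>i \<ge> 3\<close>: splitting \<open>fib_vec i\<close> into its two
  predecessors does not lower the cost. Equality is the equation that defines \<open>t_crit\<close>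
  at \<open>i\<close>.\<close>

definition critical_ineq :: "real \<Rightarrow> nat \<Rightarrow> bool" where
  "critical_ineq t i \<longleftrightarrow>
     wt (fib_vec i) powr t \<le> wt (fib_vec (i - 1)) powr t + wt (fib_vec (i - 2)) powr t"

lemma sum_mset_eq_sum_count:
  fixes f :: "nat \<Rightarrow> 'b :: comm_semiring_1"
  assumes "set_mset M \<subseteq> {1..N}"
  shows "(\<Sum>i\<in>#M. f i) = (\<Sum>i=1..N. of_nat (count M i) * f i)"
  using assms
proof (induction M)
  case (add j M)
  have "(\<Sum>i=1..N. of_nat (count (add_mset j M) i) * f i) =
      (\<Sum>i=1..N. of_nat (count M i) * f i + (if i = j then f i else 0))"
    by (intro sum.cong) (auto simp: algebra_simps)
  also have "\<dots> = (\<Sum>i=1..N. of_nat (count M i) * f i) + f j"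
    using add.prems by (simp add: sum.distrib)
  finally show ?case using add by (simp add: add_ac)
qed simp

text \<open>The multiplicities of the Fibonacci vectors in the optimal splitting form the required
  vector. The assumption \<open>crit\<close> is what decreasing critical exponents provide.\<close>

lemma lex_optimal_C_set:
  assumes opt: "lex_optimal t (fib_vec n) F" and t: "t > 1" and n: "1 \<le> n" "n \<le> N"
    and crit: "\<And>k i. 3 \<le> k \<Longrightarrow> k \<le> i \<Longrightarrow> i \<le> N \<Longrightarrow> critical_ineq t i \<Longrightarrow> critical_ineq t k"
  shows "\<exists>z\<in>C_set N n. vec_cost t z = cost t F"
proof -
  have "fst (fib_vec n) \<le> fib N" "snd (fib_vec n) \<le> fst (fib_vec n)"
    using n by (auto simp: fib_vec_pos fib_mono)
  then have "\<forall>v\<in>#F. \<exists>i. i \<in> {1..N} \<and> v = fib_vec i"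
    using lex_optimal_fib_vec[OF opt t] lex_optimal_no_fib_vec_0[OF opt t]
    by (metis One_nat_def Suc_leI atLeastAtMost_iff not_gr_zero)
  then obtain g where g: "\<And>v. v \<in># F \<Longrightarrow> g v \<in> {1..N} \<and> v = fib_vec (g v)" by metis
  define M where "M = image_mset g F"
  have M: "set_mset M \<subseteq> {1..N}" using g by (auto simp: M_def)
  have "image_mset (\<lambda>v. fib_vec (g v)) F = image_mset (\<lambda>v. v) F"
    by (rule image_mset_cong) (use g in auto)
  then have F: "F = image_mset fib_vec M" by (simp add: M_def image_mset.compositionality o_def)
  have sum: "(\<Sum>i\<in>#M. fib_vec i) = fib_vec n"
    using opt F by (simp add: lex_optimal_def splittings_def)
  have "(\<Sum>j=1..N. fib_mat 1 j * count M j) = (\<Sum>j=1..N. of_nat (count M j) * fst (fib_vec j))"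
    by (intro sum.cong) (auto simp: fib_mat_def fib_vec_pos)
  also have "\<dots> = fst (fib_vec n)"
    using sum_mset_eq_sum_count[OF M, of "\<lambda>j. fst (fib_vec j)"] sum by (simp flip: fst_sum_mset)
  finally have row1: "(\<Sum>j=1..N. fib_mat 1 j * count M j) = fst (fib_vec n)" .
  have "(\<Sum>j=1..N. fib_mat 2 j * count M j) = (\<Sum>j=1..N. of_nat (count M j) * snd (fib_vec j))"
    by (intro sum.cong) (auto simp: fib_mat_def fib_vec_pos)
  also have "\<dots> = snd (fib_vec n)"
    using sum_mset_eq_sum_count[OF M, of "\<lambda>j. snd (fib_vec j)"] sum by (simp flip: snd_sum_mset)
  finally have "count M \<in> V_set N n"
    using row1 n M by (auto simp: V_set_def nat_vecs_def fib_vec_pos not_in_iff[symmetric])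
  moreover have "almost_consecutive_free (count M)"
    unfolding almost_consecutive_free_def
  proof (intro allI impI, rule ccontr)
    fix j i assume j: "count M j * count M (j + 1) \<noteq> 0" and i: "i > j + 1" "count M i \<noteq> 0"
    have in_M: "j \<in># M" "Suc j \<in># M" "i \<in># M" using j i by (auto simp flip: count_greater_zero_iff)
    then have bounds: "1 \<le> j" "i \<le> N" using M by auto
    have "{#j, Suc j#} \<subseteq># M"
      using in_M by (auto simp: subseteq_mset_def Suc_le_eq)
    then have "image_mset fib_vec {#j, Suc j#} \<subseteq># F" unfolding F by (rule image_mset_subseteq_mono)
    then have Y: "{#fib_vec j, fib_vec (Suc j)#} \<subseteq># F" by simp
    \<comment> \<open>Merging the two parts would lower \<open>size_excess\<close>, so it must be
      strictly more expensive.\<close>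
    have "\<not> cost t {#fib_vec (Suc (Suc j))#} \<le> cost t {#fib_vec j, fib_vec (Suc j)#}"
    proof
      assume "cost t {#fib_vec (Suc (Suc j))#} \<le> cost t {#fib_vec j, fib_vec (Suc j)#}"
      then have "size_excess {#fib_vec j, fib_vec (Suc j)#} \<le> size_excess {#fib_vec (Suc (Suc j))#}"
        using lex_optimal_exchange(2)[OF opt Y, of "{#fib_vec (Suc (Suc j))#}"]
          fib_vec_nonzero[of "Suc (Suc j)"] by (auto simp: fib_vec_Suc_Suc add.commute simp del: fib_vec.simps)
      moreover have "snd (fib_vec (Suc (Suc j))) \<le> fst (fib_vec (Suc (Suc j)))"
        by (simp add: fib_mono)
      ultimately show False by (simp add: size_excess_def del: fib_vec.simps)
    qed
    then have "\<not> critical_ineq t (Suc (Suc j))" by (simp add: critical_ineq_def cost_def del: fib_vec.simps)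
    \<comment> \<open>Splitting \<open>i\<close> does not pay either, and \<open>crit\<close>
      carries this inequality down to \<open>j + 2\<close>, a contradiction.\<close>
    moreover have "critical_ineq t i"
    proof -
      have "fib_vec i = fib_vec (i - 1) + fib_vec (i - 2)"
        using fib_vec_Suc_Suc[of "i - 2"] i by (simp add: numeral_2_eq_2 Suc_diff_Suc del: fib_vec.simps)
      moreover have "{#fib_vec i#} \<subseteq># F" using in_M(3) by (simp add: F)
      ultimately have "cost t {#fib_vec i#} \<le> cost t {#fib_vec (i - 1), fib_vec (i - 2)#}"
        using lex_optimal_exchange(1)[OF opt, of "{#fib_vec i#}" "{#fib_vec (i - 1), fib_vec (i - 2)#}"]
          fib_vec_nonzero[of "i - 1"] fib_vec_nonzero[of "i - 2"] by auto
      then show ?thesis by (simp add: critical_ineq_def cost_def)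
    qed
    ultimately show False using crit[of "Suc (Suc j)" i] bounds i by auto
  qed
  ultimately have "count M \<in> C_set N n" by (simp add: C_set_def)
  moreover have "vec_cost t (count M) = cost t F"
    using sum_mset_eq_sum_count[OF M, of "\<lambda>i. wt (fib_vec i) powr t"]
    by (simp add: vec_cost_def F cost_def image_mset.compositionality o_def)
  ultimately show ?thesis by blast
qed

end

section \<open>Vectors with Fibonacci weights\<close>

definition supported_on_pair :: "nat \<Rightarrow> (nat \<Rightarrow> nat) \<Rightarrow> bool" where
  "supported_on_pair j x \<longleftrightarrow> (\<forall>i. x i \<noteq> 0 \<longrightarrow> i = j \<or> i = Suc j)"

text \<open>Subtracting the equations is a step of Euclid's algorithm and lowers both
  \<open>k\<close> and \<open>m\<close> by one.\<close>

lemma fib_pair_coordinates: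
  assumes "1 \<le> m"
    and "u * fib (Suc k) + v * fib (Suc (Suc k)) = fib m"
    and "u * fib k + v * fib (Suc k) = fib (m - 1)"
  shows "m = Suc k \<and> u = 1 \<and> v = 0 \<or> Suc k < m \<and> u = fib (m - Suc (Suc k)) \<and> v = fib (m - Suc k)"
  using assms
proof (induction k arbitrary: m)
  case 0
  consider "m = 1" | l where "m = Suc (Suc l)" using 0(1) by (metis One_nat_def Suc_le_D le_SucE not0_implies_Suc not_one_le_zero)
  then show ?case
  proof cases
    case 1
    then show ?thesis using 0 by simp
  next
    case 2
    then show ?thesis using 0 by simp
  qed
next
  case (Suc k)
  have "m \<noteq> 1"
  proof
    assume "m = 1"
    then have "u = 0" "v = 0" using Suc.prems(3) fib_neq_0_nat[of "Suc k"] fib_neq_0_nat[of "Suc (Suc k)"]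
      by auto
    then show False using Suc.prems(2) \<open>m = 1\<close> by simp
  qed
  then obtain l where l: "m = Suc (Suc l)"
    using Suc.prems(1) by (metis One_nat_def Suc_le_D le_SucE not0_implies_Suc not_one_le_zero)
  have "u * fib k + v * fib (Suc k) = fib l"
    using Suc.prems(2,3) by (simp add: l algebra_simps)
  then show ?case using Suc.IH[of "Suc l"] Suc.prems(3) by (auto simp: l)
qed

lemma sum_supported_on_pair:
  fixes f :: "nat \<Rightarrow> nat"
  assumes "x \<in> nat_vecs N" "supported_on_pair j x"
  shows "(\<Sum>i=1..N. f i * x i) = f j * x j + f (Suc j) * x (Suc j)"
proof -
  have "(\<Sum>i=1..N. f i * x i) = (\<Sum>i\<in>{j, Suc j}. f i * x i)"
    using assms by (intro sum.mono_neutral_cong) (auto simp: nat_vecs_def supported_on_pair_def)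
  then show ?thesis by simp
qed

lemma V_set_supported_on_pair_iff:
  assumes "x \<in> nat_vecs N" "supported_on_pair (Suc k) x"
  shows "x \<in> V_set N m \<longleftrightarrow>
    x (Suc k) * fib (Suc k) + x (Suc (Suc k)) * fib (Suc (Suc k)) = fib m \<and>
    x (Suc k) * fib k + x (Suc (Suc k)) * fib (Suc k) = fib (m - 1)"
  unfolding V_set_def mem_Collect_eq sum_supported_on_pair[OF assms]
  using assms(1) by (simp add: fib_mat_def mult.commute del: fib.simps)

text \<open>The matrix equations determine both entries, which are those of the unit vector at
  \<open>m\<close> or of \<open>S_vec m (k + 3)\<close>.\<close>

lemma S_set_if_supported_on_pair:
  assumes x: "x \<in> V_set N m" and m: "1 \<le> m" and supp: "supported_on_pair (Suc k) x"
  shows "x \<in> S_set m"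
proof -
  have vec: "x \<in> nat_vecs N" using x by (simp add: V_set_def)
  have "x (Suc k) * fib (Suc k) + x (Suc (Suc k)) * fib (Suc (Suc k)) = fib m"
    "x (Suc k) * fib k + x (Suc (Suc k)) * fib (Suc k) = fib (m - 1)"
    using x V_set_supported_on_pair_iff[OF vec supp] by auto
  from fib_pair_coordinates[OF m this] show ?thesis
  proof (elim disjE conjE)
    assume *: "m = Suc k" "x (Suc k) = 1" "x (Suc (Suc k)) = 0"
    then have x_eq: "x = (\<lambda>j. if j = m then 1 else 0)"
      using supp by (auto simp: supported_on_pair_def fun_eq_iff)
    show ?thesis
    proof (cases "m = 1")
      case True
      then show ?thesis by (simp add: S_set_def x_eq)
    next
      case False
      \<comment> \<open>The last vector of the family is the unit vector at \<open>m\<close>, its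
        other entry being \<open>fib 0 = 0\<close>.\<close>
      then have "x = S_vec m (m + 1)" using m by (auto simp: S_vec_def x_eq fun_eq_iff)
      then show ?thesis using False m by (auto simp: S_set_def)
    qed
  next
    assume *: "Suc k < m" "x (Suc k) = fib (m - Suc (Suc k))" "x (Suc (Suc k)) = fib (m - Suc k)"
    then have "x = S_vec m (k + 3)"
      using supp by (auto simp: supported_on_pair_def S_vec_def fun_eq_iff numeral_3_eq_3)
    then show ?thesis using * by (auto simp: S_set_def)
  qed
qed

lemma supported_on_pair_if_S_set:
  assumes "x \<in> S_set n" "1 \<le> n"
  shows "\<exists>k. supported_on_pair (Suc k) x"
proof (cases "n = 1")
  case True
  then show ?thesis using assms by (intro exI[of _ 0]) (auto simp: S_set_def supported_on_pair_def)
next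
  case False
  then obtain i where "x = S_vec n i" "3 \<le> i" using assms by (auto simp: S_set_def)
  then show ?thesis
    by (intro exI[of _ "i - 3"]) (auto simp: S_vec_def supported_on_pair_def split: if_splits)
qed

text \<open>For \<open>n > 1\<close>, the matrix equations are instances of the addition formula for
  Fibonacci numbers.\<close>

lemma S_set_subset_V_set:
  assumes "1 \<le> n" "n \<le> N"
  shows "S_set n \<subseteq> V_set N n"
proof
  fix x assume x: "x \<in> S_set n"
  obtain k where supp: "supported_on_pair (Suc k) x" using supported_on_pair_if_S_set[OF x assms(1)] ..
  show "x \<in> V_set N n"
  proof (cases "n = 1")
    case True
    then have "x = (\<lambda>j. if j = 1 then 1 else 0)" using x by (simp add: S_set_def)
    then show ?thesis using assms
      by (auto simp: V_set_def nat_vecs_def fib_mat_def True if_distrib cong: if_cong)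
  next
    case False
    then obtain i where i: "x = S_vec n i" "3 \<le> i" "i \<le> n + 1" using x by (auto simp: S_set_def)
    \<comment> \<open>Writing \<open>i = j + 3\<close> and \<open>n = l + j + 2\<close> removes the
      truncated subtractions.\<close>
    define j where "j = i - 3"
    define l where "l = n + 1 - i"
    have j: "i = j + 3" "n = l + Suc (Suc j)" using i by (auto simp: j_def l_def)
    have x_eq: "x = (\<lambda>r. if r = Suc j then fib l else if r = Suc (Suc j) then fib (Suc l) else 0)"
      by (auto simp: i(1) S_vec_def j fun_eq_iff Suc_diff_le)
    have vec: "x \<in> nat_vecs N" using j assms by (auto simp: x_eq nat_vecs_def)
    have supp: "supported_on_pair (Suc j) x" by (auto simp: x_eq supported_on_pair_def)
    show ?thesis unfolding V_set_supported_on_pair_iff[OF vec supp]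
      using fib_add[of l "Suc j"] fib_add[of l j]
      by (auto simp: x_eq j algebra_simps simp del: fib.simps)
  qed
qed

lemma S_set_subset_C_set:
  assumes "1 \<le> n" "n \<le> N"
  shows "S_set n \<subseteq> C_set N n"
proof
  fix x assume x: "x \<in> S_set n"
  obtain k where "supported_on_pair (Suc k) x" using supported_on_pair_if_S_set[OF x assms(1)] ..
  then have "almost_consecutive_free x"
    unfolding almost_consecutive_free_def supported_on_pair_def
    by (metis Suc_eq_plus1 mult_is_0 n_not_Suc_n less_irrefl_nat less_SucI lessI)
  then show "x \<in> C_set N n" using x S_set_subset_V_set[OF assms] by (auto simp: C_set_def)
qed

section \<open>Factorizations and restricted vectors\<close>

lemma factorization_member_le:
  assumes "F \<in> factorizations N n z" "x \<in># F"
  shows "x j \<le> z j"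
proof -
  obtain G where "F = add_mset x G" using assms(2) by (rule mset_add)
  then show ?thesis using assms(1) by (simp add: factorizations_def)
qed

text \<open>Every factor is bounded by \<open>z\<close>, so it lives on the same two adjacent
  positions, where membership in \<open>V_set N m\<close> forces membership in
  \<open>S_set m\<close>.\<close>

lemma S_set_subset_R_set:
  assumes "1 \<le> n" "n \<le> N"
  shows "S_set n \<subseteq> R_set N n"
proof
  fix z assume z: "z \<in> S_set n"
  obtain k where supp: "supported_on_pair (Suc k) z" using supported_on_pair_if_S_set[OF z assms(1)] ..
  have "S_type n F" if F: "F \<in> factorizations N n z" for F
    unfolding S_type_def
  proof
    fix x assume x: "x \<in># F"
    then obtain m where m: "m \<in> {1..n}" "x \<in> V_set N m" using F by (auto simp: factorizations_def)
    have "supported_on_pair (Suc k) x"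
      using supp factorization_member_le[OF F x] unfolding supported_on_pair_def
      by (metis le_zero_eq)
    then show "x \<in> (\<Union>i\<in>{1..n}. S_set i)" using S_set_if_supported_on_pair[OF m(2)] m(1) by (meson UN_I atLeastAtMost_iff)
  qed
  then show "z \<in> R_set N n"
    using z S_set_subset_C_set[OF assms] by (auto simp: R_set_def S_restricted_def)
qed

text \<open>This vector is the representation of the number by itself. It keeps the sets nonempty
  over which minima are taken.\<close>

lemma unit_vec_in_S_set:
  assumes "1 \<le> n"
  shows "(\<lambda>j. if j = n then 1 else 0) \<in> S_set n"
proof (cases "n = 1")
  case False
  then have "(\<lambda>j. if j = n then 1 else 0) = S_vec n (n + 1)"
    using assms by (auto simp: S_vec_def fun_eq_iff)
  then show ?thesis using False assms by (auto simp: S_set_def)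
qed (simp add: S_set_def)

lemma finite_C_set: "finite (C_set N n)"
  using finite_V_set by (rule finite_subset[rotated]) (auto simp: C_set_def)

lemma R_set_subset_C_set: "R_set N n \<subseteq> C_set N n"
  by (auto simp: R_set_def)

lemma C_set_subset_V_set: "C_set N n \<subseteq> V_set N n"
  by (auto simp: C_set_def)

text \<open>A factorization that violates the restriction has, besides the bad factor
  \<open>x\<close>, a second factor. That one takes a positive share of the first row sum, so the
  index of \<open>x\<close> is below \<open>n\<close>.\<close>

lemma non_restricted_factor:
  assumes z: "z \<in> C_set N n" "z \<notin> R_set N n" and n: "1 \<le> n"
  obtains x i where "1 \<le> i" "i < n" "x \<in> V_set N i" "x \<notin> S_set i" "\<And>j. x j \<le> z j"
proof -
  obtain F where F: "F \<in> factorizations N n z" "F \<noteq> {#z#}" "\<not> S_type n F"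
    using z by (auto simp: R_set_def S_restricted_def)
  then obtain x where x: "x \<in># F" "x \<notin> (\<Union>i\<in>{1..n}. S_set i)" by (auto simp: S_type_def)
  then obtain i where i: "i \<in> {1..n}" "x \<in> V_set N i" using F(1) by (auto simp: factorizations_def)
  obtain G where G: "F = add_mset x G" using x(1) by (rule mset_add)
  have z_eq: "z j = x j + (\<Sum>y\<in>#G. y j)" for j using F(1) G by (simp add: factorizations_def)
  have "G \<noteq> {#}"
  proof
    assume "G = {#}"
    then have "z = x" using z_eq by (auto simp: fun_eq_iff)
    then show False using F(2) G \<open>G = {#}\<close> by simp
  qed
  then obtain y H where H: "G = add_mset y H" by (cases G) auto
  then obtain k where k: "k \<in> {1..n}" "y \<in> V_set N k" using F(1) G by (auto simp: factorizations_def)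
  have "fib i + fib k = (\<Sum>j=1..N. fib_mat 1 j * x j) + (\<Sum>j=1..N. fib_mat 1 j * y j)"
    using i k by (simp add: V_set_def)
  also have "\<dots> = (\<Sum>j=1..N. fib_mat 1 j * (x j + y j))"
    by (simp add: sum.distrib algebra_simps)
  also have "\<dots> \<le> (\<Sum>j=1..N. fib_mat 1 j * z j)"
    by (intro sum_mono mult_left_mono) (auto simp: z_eq H)
  also have "\<dots> = fib n" using z by (simp add: C_set_def V_set_def)
  finally have "fib i + fib k \<le> fib n" .
  moreover have "fib k > 0" using k by (simp add: fib_neq_0_nat)
  ultimately have "i \<noteq> n" by auto
  then show ?thesis using i x that[of i x] z_eq by auto
qed

text \<open>The matrix equations are linear, and \<open>le\<close> makes the truncated subtraction
  exact.\<close>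

lemma V_set_exchange:
  assumes z: "z \<in> V_set N n" and x: "x \<in> V_set N i" and s: "s \<in> V_set N i" and le: "\<And>j. x j \<le> z j"
  shows "(\<lambda>j. z j - x j + s j) \<in> V_set N n"
proof -
  have "(\<Sum>j=1..N. fib_mat r j * (z j - x j + s j)) = (\<Sum>j=1..N. fib_mat r j * z j)"
    if "(\<Sum>j=1..N. fib_mat r j * x j) = (\<Sum>j=1..N. fib_mat r j * s j)" for r
  proof -
    have "(\<Sum>j=1..N. fib_mat r j * (z j - x j + s j)) + (\<Sum>j=1..N. fib_mat r j * x j) =
        (\<Sum>j=1..N. fib_mat r j * (z j - x j + s j + x j))"
      by (simp only: sum.distrib add_mult_distrib2)
    also have "\<dots> = (\<Sum>j=1..N. fib_mat r j * (z j + s j))"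
    proof -
      have eq: "z j - x j + s j + x j = z j + s j" for j using le[of j] by simp
      show ?thesis unfolding eq ..
    qed
    also have "\<dots> = (\<Sum>j=1..N. fib_mat r j * z j) + (\<Sum>j=1..N. fib_mat r j * s j)"
      by (simp only: sum.distrib add_mult_distrib2)
    finally show ?thesis using that by simp
  qed
  then show ?thesis using z x s by (auto simp: V_set_def nat_vecs_def)
qed

section \<open>Exponential sums\<close>

lemma powr_tendsto_0_at_top:
  fixes r :: real
  assumes "0 < r" "r < 1"
  shows "((\<lambda>t. r powr t) \<longlongrightarrow> 0) at_top"
proof -
  have "filterlim (\<lambda>t. ln r * t) at_bot at_top"
    using assms by (intro filterlim_tendsto_neg_mult_at_bot[OF tendsto_const _ filterlim_ident]) auto
  then have "((\<lambda>t. exp (ln r * t)) \<longlongrightarrow> 0) at_top"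
    by (rule filterlim_compose[OF exp_at_bot])
  then show ?thesis using assms by (simp add: powr_def mult.commute)
qed

text \<open>The sum extends to an entire function, which has countably many zeros unless it is
  identically zero. The term with the largest base dominates as \<open>t\<close> grows and excludes
  that case.\<close>

lemma countable_zeros_powr_sum:
  fixes c d :: "'i \<Rightarrow> real"
  assumes fin: "finite I" and c: "\<And>i. i \<in> I \<Longrightarrow> c i > 0" "inj_on c I"
    and d: "\<exists>i\<in>I. d i \<noteq> 0"
  shows "countable {t :: real. (\<Sum>i\<in>I. d i * c i powr t) = 0}"
proof -
  define g where "g z = (\<Sum>i\<in>I. of_real (d i) * exp (of_real (ln (c i)) * z))" for z :: complex
  have g_real: "g (of_real t) = of_real (\<Sum>i\<in>I. d i * c i powr t)" for t
    unfolding g_def of_real_sum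
  proof (rule sum.cong)
    fix i assume "i \<in> I"
    then have "c i powr t = exp (ln (c i) * t)" using c(1)[of i] by (simp add: powr_def mult.commute)
    then show "of_real (d i) * exp (of_real (ln (c i)) * of_real t) = of_real (d i * c i powr t)"
      by (simp add: exp_of_real flip: of_real_mult)
  qed simp
  obtain k where k: "k \<in> I" "d k \<noteq> 0" "\<And>i. i \<in> I \<Longrightarrow> d i \<noteq> 0 \<Longrightarrow> c i \<le> c k"
  proof -
    let ?J = "{i\<in>I. d i \<noteq> 0}"
    have "finite (c ` ?J)" "c ` ?J \<noteq> {}" using fin d by auto
    then have "Max (c ` ?J) \<in> c ` ?J" by (rule Max_in)
    then obtain k where "k \<in> ?J" "c k = Max (c ` ?J)" by auto
    then show ?thesis using that[of k] Max_ge[OF \<open>finite (c ` ?J)\<close>] by auto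
  qed
  have term_lim: "((\<lambda>t. d i * (c i / c k) powr t) \<longlongrightarrow> (if i = k then d k else 0)) at_top"
    if "i \<in> I" for i
  proof -
    consider "i = k" | "d i = 0" "i \<noteq> k" | "d i \<noteq> 0" "i \<noteq> k" by blast
    then show ?thesis
    proof cases
      case 3
      then have "c i < c k" using k that c(2) by (metis inj_onD order_le_less)
      then have "((\<lambda>t. (c i / c k) powr t) \<longlongrightarrow> 0) at_top"
        using c(1) that k(1) by (intro powr_tendsto_0_at_top) auto
      then show ?thesis using 3 by (auto intro: tendsto_mult_right_zero)
    qed (use k c(1)[of k] in auto)
  qed
  have "((\<lambda>t. \<Sum>i\<in>I. d i * (c i / c k) powr t) \<longlongrightarrow> (\<Sum>i\<in>I. if i = k then d k else 0)) at_top"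
    by (intro tendsto_sum term_lim)
  then have "((\<lambda>t. \<Sum>i\<in>I. d i * (c i / c k) powr t) \<longlongrightarrow> d k) at_top"
    using fin k(1) by simp
  then have "eventually (\<lambda>t. (\<Sum>i\<in>I. d i * (c i / c k) powr t) \<noteq> 0) at_top"
    using k(2) by (rule tendsto_imp_eventually_ne)
  then obtain T where T: "(\<Sum>i\<in>I. d i * (c i / c k) powr T) \<noteq> 0"
    using eventually_happens'[OF trivial_limit_at_top_linorder] by blast
  have "(\<Sum>i\<in>I. d i * (c i / c k) powr T) = (\<Sum>i\<in>I. d i * c i powr T) / c k powr T"
    unfolding sum_divide_distrib by (intro sum.cong) (use c(1) k(1) in \<open>auto simp: powr_divide less_imp_le\<close>)
  then have "(\<Sum>i\<in>I. d i * c i powr T) \<noteq> 0" using T by simp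
  then have gT: "g (of_real T) \<noteq> 0" unfolding g_real of_real_eq_0_iff .
  have zeros: "countable {z. g z = 0}"
  proof (cases "g constant_on UNIV")
    case True
    then have "g z \<noteq> 0" for z using gT by (auto simp: constant_on_def)
    then show ?thesis by simp
  next
    case False
    have "g holomorphic_on UNIV" unfolding g_def by (intro holomorphic_intros)
    then have "countable {z\<in>UNIV. g z = 0}"
      using False by (intro holomorphic_countable_zeros) auto
    then show ?thesis by simp
  qed
  have "of_real ` {t. (\<Sum>i\<in>I. d i * c i powr t) = 0} \<subseteq> {z. g z = 0}"
  proof (intro subsetI, elim imageE)
    fix z t assume z: "z = complex_of_real t" and "t \<in> {t. (\<Sum>i\<in>I. d i * c i powr t) = 0}"
    then show "z \<in> {z. g z = 0}" unfolding z mem_Collect_eq g_real of_real_eq_0_iff by simp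
  qed
  then have "countable ((of_real :: real \<Rightarrow> complex) ` {t. (\<Sum>i\<in>I. d i * c i powr t) = 0})"
    using zeros countable_subset by blast
  then show ?thesis by (rule countable_image_inj_on) (simp add: inj_on_def)
qed

text \<open>The quotient of \<open>a powr t + b powr t\<close> by \<open>c powr t\<close> decreases
  strictly from 2 at \<open>t = 0\<close> to the limit 0, so it takes the value 1 exactly
  once.\<close>

lemma critical_exponent:
  fixes a b c :: real
  assumes "0 < a" "a < c" "0 < b" "b < c"
  shows "\<exists>t0>0. \<forall>t. (c powr t \<le> a powr t + b powr t \<longleftrightarrow> t \<le> t0) \<and> (c powr t = a powr t + b powr t \<longleftrightarrow> t = t0)"
proof -
  define g where "g t = (a / c) powr t + (b / c) powr t" for t
  have dec: "g t < g s" if "s < t" for s t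
    unfolding g_def using assms that by (intro add_strict_mono powr_less_mono') auto
  have "(g \<longlongrightarrow> 0 + 0) at_top"
    unfolding g_def using assms by (intro tendsto_add powr_tendsto_0_at_top) auto
  then have "eventually (\<lambda>t. g t < 1) at_top" by (intro order_tendstoD(2)) auto
  then obtain T where T: "g T < 1"
    using eventually_happens'[OF trivial_limit_at_top_linorder] by blast
  have g0: "g 0 = 2" using assms by (simp add: g_def)
  have "T > 0" using T g0 dec[of T 0] by (cases T "0 :: real" rule: linorder_cases) auto
  moreover have "continuous_on {0..T} g"
    unfolding g_def using assms by (intro continuous_intros) auto
  ultimately obtain t0 where t0: "0 \<le> t0" "t0 \<le> T" "g t0 = 1"
    using IVT2'[of g T 1 0] T g0 by auto
  have "t0 \<noteq> 0" using t0 g0 by auto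
  then have pos: "t0 > 0" using t0 by simp
  have scale: "c powr t * g t = a powr t + b powr t" for t
    using assms by (simp add: g_def powr_divide distrib_left)
  have "c powr t \<le> a powr t + b powr t \<longleftrightarrow> 1 \<le> g t" for t
    using assms by (simp flip: scale add: mult_le_cancel_left1)
  moreover have "c powr t = a powr t + b powr t \<longleftrightarrow> g t = 1" for t
    using assms by (auto simp flip: scale)
  moreover have "(1 \<le> g t \<longleftrightarrow> t \<le> t0) \<and> (g t = 1 \<longleftrightarrow> t = t0)" for t
    using dec[of t t0] dec[of t0 t] t0(3) by (cases t t0 rule: linorder_cases) auto
  ultimately show ?thesis using pos by blast
qed

section \<open>Vector costs as functions of the exponent\<close>

context fib_weights
begin

lemma wt_fib_vec: "i \<le> N \<Longrightarrow> wt (fib_vec i) = (if odd i then real (fst (fib_vec i)) * P else real (snd (fib_vec i)) * Q)"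
  using sign_odd[of i] sign_even[of i] by (simp add: wt_def)

text \<open>The coordinate giving the weight of \<open>fib_vec i\<close> does not decrease at
  \<open>i + 1\<close>, and there the sign condition makes the other coordinate dominate
  strictly.\<close>

lemma wt_fib_vec_less_Suc:
  assumes "1 \<le> i" "Suc i \<le> N"
  shows "wt (fib_vec i) < wt (fib_vec (Suc i))"
proof -
  have fib: "fib i \<le> fib (Suc i)" "fib (i - 1) \<le> fib i" by (auto intro: fib_mono)
  show ?thesis
  proof (cases "odd i")
    case True
    have "real (fib i) * P \<le> real (fib (Suc i)) * P" using fib P_pos by (intro mult_right_mono) auto
    then show ?thesis using True sign_even[of "Suc i"] assms wt_fib_vec[of i] wt_fib_vec[of "Suc i"]
      by (simp add: fib_vec_pos del: fib.simps)
  next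
    case False
    have "real (fib (i - 1)) * Q \<le> real (fib i) * Q" using fib Q_pos by (intro mult_right_mono) auto
    then show ?thesis using False sign_odd[of "Suc i"] assms wt_fib_vec[of i] wt_fib_vec[of "Suc i"]
      by (simp add: fib_vec_pos del: fib.simps)
  qed
qed

lemma wt_fib_vec_strict_mono:
  assumes "1 \<le> i" "i < j" "j \<le> N"
  shows "wt (fib_vec i) < wt (fib_vec j)"
  using assms(2,3)
proof (induction j)
  case (Suc j)
  then show ?case
    using wt_fib_vec_less_Suc[of j] assms(1) by (cases "i = j") (auto simp del: fib_vec.simps)
qed simp

lemma inj_on_wt_fib_vec: "inj_on (\<lambda>i. wt (fib_vec i)) {1..N}"
  by (rule linorder_inj_onI) (use wt_fib_vec_strict_mono in force)+

lemma countable_vec_cost_eq: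
  assumes "x \<in> nat_vecs N" "y \<in> nat_vecs N" "x \<noteq> y"
  shows "countable {t. vec_cost t x = vec_cost t y}"
proof -
  obtain j where "x j \<noteq> y j" using assms(3) by auto
  then have "j \<in> {1..N}" using assms by (auto simp: nat_vecs_def)
  then have "countable {t. (\<Sum>i=1..N. (real (x i) - real (y i)) * wt (fib_vec i) powr t) = 0}"
    using \<open>x j \<noteq> y j\<close> inj_on_wt_fib_vec wt_pos fib_vec_nonzero
    by (intro countable_zeros_powr_sum) auto
  then show ?thesis by (simp add: vec_cost_def left_diff_distrib sum_subtractf)
qed

lemma tendsto_vec_cost: "((\<lambda>t. vec_cost t x) \<longlongrightarrow> vec_cost t0 x) (nhds t0)"
  unfolding vec_cost_def using wt_pos[OF fib_vec_nonzero]
  by (intro tendsto_intros filterlim_ident) (auto simp: less_le)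

text \<open>The pairs may add up to more than \<open>(a, b)\<close>, so each in turn is cut down to
  what is still needed, which does not raise its weight. Pairs cut down to zero are dropped.\<close>

lemma splitting_of_list:
  assumes "a \<le> (\<Sum>v\<leftarrow>vs. fst v)" "b \<le> (\<Sum>v\<leftarrow>vs. snd v)" "t > 0"
  shows "\<exists>F\<in>splittings (a, b). cost t F \<le> (\<Sum>v\<leftarrow>vs. wt v powr t)"
  using assms(1,2)
proof (induction vs arbitrary: a b)
  case Nil
  then show ?case by (intro bexI[of _ "{#}"]) (auto simp: splittings_def cost_def zero_prod_def)
next
  case (Cons v vs)
  define u where "u = (min a (fst v), min b (snd v))"
  have "a - fst u \<le> (\<Sum>v\<leftarrow>vs. fst v)" "b - snd u \<le> (\<Sum>v\<leftarrow>vs. snd v)"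
    using Cons.prems by (auto simp: u_def)
  then obtain F where F: "F \<in> splittings (a - fst u, b - snd u)" "cost t F \<le> (\<Sum>v\<leftarrow>vs. wt v powr t)"
    using Cons.IH by blast
  have sum: "(a - fst u, b - snd u) + u = (a, b)" by (auto simp: u_def)
  have "wt u \<le> wt v" unfolding wt_def u_def using P_pos Q_pos
    by (intro max.mono mult_right_mono) auto
  then have le: "wt u powr t \<le> wt v powr t" using assms(3) wt_nonneg by (intro powr_mono2) auto
  show ?case
  proof (cases "u = 0")
    case True
    then have "F \<in> splittings (a, b)" using F(1) sum by simp
    then show ?thesis using F(2) by (intro bexI[of _ F]) (auto intro: add_increasing)
  next
    case False
    then have "add_mset u F \<in> splittings (a, b)"
      using F(1) sum by (auto simp: splittings_def add.commute)
    then show ?thesis using F(2) le by (intro bexI[of _ "add_mset u F"]) (auto simp: cost_def)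
  qed
qed

text \<open>For \<open>t > 1\<close> a lexicographically optimal splitting gives the vector; for
  \<open>t \<le> 1\<close> leaving \<open>fib_vec n\<close> unsplit is best.\<close>

lemma C_set_le_cost:
  assumes F: "F \<in> splittings (fib_vec n)" and t: "t > 0" and n: "1 \<le> n" "n \<le> N"
    and crit: "\<And>k i. 3 \<le> k \<Longrightarrow> k \<le> i \<Longrightarrow> i \<le> N \<Longrightarrow> critical_ineq t i \<Longrightarrow> critical_ineq t k"
  shows "\<exists>z\<in>C_set N n. vec_cost t z \<le> cost t F"
proof (cases "t > 1")
  case True
  obtain G where G: "lex_optimal t (fib_vec n) G" using lex_optimal_exists[OF F] ..
  then have "cost t G \<le> cost t F" using F by (simp add: lex_optimal_def)
  moreover have "\<exists>z\<in>C_set N n. vec_cost t z = cost t G"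
    by (rule lex_optimal_C_set[OF G True n]) (rule crit)
  ultimately show ?thesis by metis
next
  case False
  let ?z = "\<lambda>j. if j = n then 1 else 0 :: nat"
  have "?z \<in> C_set N n" using unit_vec_in_S_set S_set_subset_C_set n by blast
  moreover have "vec_cost t ?z = (\<Sum>i=1..N. if i = n then wt (fib_vec i) powr t else 0)"
    unfolding vec_cost_def by (intro sum.cong) auto
  then have "vec_cost t ?z = wt (sum_mset F) powr t"
    using n F by (simp add: splittings_def)
  moreover have "wt (sum_mset F) powr t \<le> cost t F" using wt_sum_mset_ge t False by simp
  ultimately show ?thesis by metis
qed

end

section \<open>Compatible primes\<close>

text \<open>The differences \<open>\<delta> i\<close> obey the Fibonacci recurrence, and (W) says
  that the last two have opposite signs. This descends, since
  \<open>\<delta> (i + 1) * \<delta> i\<close> is \<open>\<delta> (i + 2) * \<delta> (i + 1)\<close>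
  minus a square. Finally \<open>\<delta> 0 < 0\<close> fixes the parity.\<close>

lemma cond_W_fib_weights:
  assumes N: "3 \<le> N" and pq: "prime p" "prime q" and W: "cond_W N p q"
  shows "fib_weights N (ln (real p)) (ln (real q))"
proof -
  have "1 < real p" "1 < real q" using pq prime_gt_1_nat by auto
  then have pos: "0 < ln (real p)" "0 < ln (real q)" by (auto simp: ln_gt_zero)
  define \<delta> where "\<delta> i = real (fst (fib_vec i)) * ln (real p) - real (snd (fib_vec i)) * ln (real q)" for i
  have rec: "\<delta> (Suc (Suc i)) = \<delta> (Suc i) + \<delta> i" for i
    unfolding \<delta>_def fib_vec_Suc_Suc by (simp add: algebra_simps del: fib_vec.simps)
  define m where "m = N - 3"
  have m: "N = Suc (Suc (Suc m))" using N by (simp add: m_def)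
  have fib_pos: "0 < fib (Suc m)" "0 < fib (Suc (Suc m))" by (auto intro: fib_neq_0_nat)
  have "\<delta> N * \<delta> (N - 1) < 0"
    using W pos fib_pos unfolding cond_W_def Let_def mult_less_0_iff \<delta>_def m
    by (auto simp: field_simps simp del: fib.simps)
  then have "\<delta> (Suc (Suc (Suc m))) * \<delta> (Suc (Suc m)) < 0" by (simp add: m)
  have alt: "\<delta> (Suc i) * \<delta> i < 0" if "i < N" for i
  proof -
    have "i \<le> Suc (Suc m)" using that m by simp
    then show ?thesis
    proof (induction i rule: inc_induct)
      case base
      then show ?case by fact
    next
      case (step i)
      have "\<delta> (Suc i) * \<delta> i = \<delta> (Suc (Suc i)) * \<delta> (Suc i) - \<delta> (Suc i) * \<delta> (Suc i)"
        by (simp add: rec algebra_simps)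
      moreover have "0 \<le> \<delta> (Suc i) * \<delta> (Suc i)" by simp
      ultimately show ?case using step.IH by linarith
    qed
  qed
  have sign: "if odd i then \<delta> i > 0 else \<delta> i < 0" if "i \<le> N" for i
    using that
  proof (induction i)
    case 0
    then show ?case using pos by (simp add: \<delta>_def)
  next
    case (Suc i)
    then show ?case using alt[of i] by (auto simp: mult_less_0_iff split: if_splits)
  qed
  show ?thesis
  proof
    fix i assume "i \<le> N"
    then show "odd i \<Longrightarrow> real (snd (fib_vec i)) * ln (real q) < real (fst (fib_vec i)) * ln (real p)"
      "even i \<Longrightarrow> real (fst (fib_vec i)) * ln (real p) < real (snd (fib_vec i)) * ln (real q)"
      using sign[of i] by (auto simp: \<delta>_def)
  qed (use N pos in auto)
qed

lemma prod_list_concat_replicate: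
  "prod_list (concat (map (\<lambda>i. replicate (x i) (g i)) is)) = (\<Prod>i\<leftarrow>is. g i ^ x i :: 'b :: comm_monoid_mult)"
  by (induction "is") auto

lemma sum_list_concat_replicate:
  "sum_list (map h (concat (map (\<lambda>i. replicate (x i) (g i)) is))) = (\<Sum>i\<leftarrow>is. of_nat (x i) * h (g i) :: 'b :: comm_semiring_1)"
  by (induction "is") (auto simp: sum_list_replicate)

locale compatible_primes =
  fixes N p q :: nat
  assumes N_ge_3: "3 \<le> N" and p: "prime p" and q: "prime q" and compatible: "compatible N p q"
begin

sublocale fib_weights N "ln (real p)" "ln (real q)"
  using cond_W_fib_weights N_ge_3 p q compatible by (simp add: compatible_def)

lemma p_neq_q: "p \<noteq> q"
  using P_less_Q by auto

lemma log_mahler_fib_quot: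
  assumes "1 \<le> i"
  shows "log_mahler (fib_quot p q i) = wt (fib_vec i)"
proof -
  have pos: "0 < p" "0 < q" using p q by (auto simp: prime_gt_0_nat)
  have "coprime p q" using p q p_neq_q by (simp add: primes_coprime)
  then have "log_mahler (of_nat (p ^ fib i) / of_nat (q ^ fib (i - 1))) =
      ln (max (real (p ^ fib i)) (real (q ^ fib (i - 1))))"
    using pos by (intro log_mahler_of_nat_divide) auto
  also have "\<dots> = max (ln (real (p ^ fib i))) (ln (real (q ^ fib (i - 1))))"
    using pos by (auto simp: max_def)
  also have "\<dots> = wt (fib_vec i)"
    using pos assms by (simp add: wt_def fib_vec_pos ln_realpow)
  finally show ?thesis by (simp add: fib_quot_def)
qed

lemma critical_ineq_iff:
  assumes "3 \<le> i" "i \<le> N"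
  shows "critical_ineq t i \<longleftrightarrow> t \<le> t_crit p q i"
proof -
  let ?w = "\<lambda>j. wt (fib_vec j)"
  have "?w (i - 1) < ?w i" "?w (i - 2) < ?w i"
    using assms by (intro wt_fib_vec_strict_mono; simp)+
  then obtain t0 where t0: "t0 > 0"
    "\<And>t. ?w i powr t \<le> ?w (i - 1) powr t + ?w (i - 2) powr t \<longleftrightarrow> t \<le> t0"
    "\<And>t. ?w i powr t = ?w (i - 1) powr t + ?w (i - 2) powr t \<longleftrightarrow> t = t0"
    using critical_exponent[of "?w (i - 1)" "?w i" "?w (i - 2)"] wt_pos[OF fib_vec_nonzero] by blast
  have "t_crit p q i = t0"
    unfolding t_crit_def
  proof (rule the_equality)
    fix t assume "t > 0 \<and> log_mahler (fib_quot p q i) powr t =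
      log_mahler (fib_quot p q (i - 1)) powr t + log_mahler (fib_quot p q (i - 2)) powr t"
    then show "t = t0" using assms t0(3) by (simp add: log_mahler_fib_quot)
  qed (use assms t0(1) t0(3)[of t0] in \<open>simp add: log_mahler_fib_quot\<close>)
  then show ?thesis using t0(2) by (simp add: critical_ineq_def)
qed

text \<open>Compatibility makes the critical exponents decrease in the index. This supplies the
  assumption \<open>crit\<close> above.\<close>

lemma critical_ineq_antimono:
  assumes "3 \<le> k" "k \<le> i" "i \<le> N" "critical_ineq t i"
  shows "critical_ineq t k"
proof -
  have "t_crit p q i \<le> t_crit p q k"
    using assms(2,3)
  proof (induction i rule: dec_induct)
    case (step i)
    then have "t_crit p q (Suc i) < t_crit p q i"
      using compatible assms(1) by (simp add: compatible_def)
    with step show ?case by simp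
  qed simp
  then show ?thesis using assms critical_ineq_iff by fastforce
qed

lemma vec_cost_nonneg: "vec_cost t x \<ge> 0"
  unfolding vec_cost_def by (intro sum_nonneg) auto

lemma f_vec_eq: "f_vec N p q x t = vec_cost t x powr (1 / t)"
proof -
  have "(\<Sum>i=1..N. real (x i) * log_mahler (fib_quot p q i) powr t) = vec_cost t x"
    unfolding vec_cost_def by (intro sum.cong) (auto simp: log_mahler_fib_quot)
  then show ?thesis unfolding f_vec_def by (rule arg_cong)
qed

lemma f_vec_le_iff: "t > 0 \<Longrightarrow> f_vec N p q x t \<le> f_vec N p q y t \<longleftrightarrow> vec_cost t x \<le> vec_cost t y"
  unfolding f_vec_eq using vec_cost_nonneg
  by (metis not_le powr_less_mono2 powr_mono2 less_imp_le zero_less_divide_1_iff)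

section \<open>Vectors and product representations\<close>

text \<open>Take \<open>fib_quot p q i\<close> exactly \<open>x i\<close> times; the two rows of the
  matrix equation compare the exponents of \<open>p\<close> and \<open>q\<close>.\<close>

lemma V_set_representation:
  assumes x: "x \<in> V_set N n" and n: "1 \<le> n"
  shows "\<exists>\<beta>s\<in>product_representations (fib_quot p q n). f_rep \<beta>s t = f_vec N p q x t"
proof -
  define \<beta>s where "\<beta>s = concat (map (\<lambda>i. replicate (x i) (fib_quot p q i)) [1..<Suc N])"
  have pos: "0 < p" "0 < q" using p q by (auto simp: prime_gt_0_nat)
  have "prod_list \<beta>s = (\<Prod>i=1..N. fib_quot p q i ^ x i)"
    unfolding \<beta>s_def prod_list_concat_replicate
    by (subst prod.distinct_set_conv_list[symmetric]) (simp_all only: distinct_upt set_upt atLeastLessThanSuc_atLeastAtMost)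
  also have "\<dots> = of_nat p ^ (\<Sum>i=1..N. fib_mat 1 i * x i) / of_nat q ^ (\<Sum>i=1..N. fib_mat 2 i * x i)"
    unfolding power_sum prod_dividef[symmetric]
    by (intro prod.cong) (auto simp: fib_quot_def fib_mat_def power_divide power_mult)
  also have "\<dots> = fib_quot p q n" using x by (simp add: V_set_def fib_quot_def)
  finally have prod: "prod_list \<beta>s = fib_quot p q n" .
  have "\<beta>s \<noteq> []"
  proof
    assume "\<beta>s = []"
    then have zero: "\<forall>i\<in>{1..N}. x i = 0" by (auto simp: \<beta>s_def)
    have "fib n = (\<Sum>i=1..N. fib_mat 1 i * x i)" using x by (simp add: V_set_def)
    also have "\<dots> = 0" using zero by (intro sum.neutral) simp
    finally have "fib n = 0" .
    then show False using n fib_neq_0_nat[of n] by simp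
  qed
  moreover have "algebraic (fib_quot p q i) \<and> fib_quot p q i \<noteq> 0" for i
    using pos algebraic_of_nat_divide[of "p ^ fib i" "q ^ fib (i - 1)"] by (simp add: fib_quot_def)
  then have "\<forall>\<beta>\<in>set \<beta>s. algebraic \<beta> \<and> \<beta> \<noteq> 0" by (auto simp: \<beta>s_def)
  ultimately have "\<beta>s \<in> product_representations (fib_quot p q n)"
    using prod by (simp add: product_representations_def)
  moreover have "(\<Sum>\<beta>\<leftarrow>\<beta>s. log_mahler \<beta> powr t) = (\<Sum>i=1..N. real (x i) * log_mahler (fib_quot p q i) powr t)"
    unfolding \<beta>s_def sum_list_concat_replicate
    by (subst sum.distinct_set_conv_list[symmetric]) (simp_all only: distinct_upt set_upt atLeastLessThanSuc_atLeastAtMost)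
  then have "f_rep \<beta>s t = f_vec N p q x t" unfolding f_rep_def f_vec_def by (rule arg_cong)
  ultimately show ?thesis by blast
qed

text \<open>The factors become exponent pairs, which are trimmed to a splitting of
  \<open>fib_vec n\<close> and then turned into a vector of \<open>C_set N n\<close>. No step raises
  the cost.\<close>

lemma C_set_le_representation:
  assumes \<beta>s: "\<beta>s \<in> product_representations (fib_quot p q n)" and t: "t > 0" and n: "1 \<le> n" "n \<le> N"
  shows "\<exists>z\<in>C_set N n. f_vec N p q z t \<le> f_rep \<beta>s t"
proof -
  let ?vs = "map (factor_exponents p q) \<beta>s"
  have "fib n \<le> (\<Sum>v\<leftarrow>?vs. fst v)" "fib (n - 1) \<le> (\<Sum>v\<leftarrow>?vs. snd v)"
    using sum_factor_exponents_ge[OF p q p_neq_q] \<beta>s by (auto simp: fib_quot_def o_def)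
  then obtain F where F: "F \<in> splittings (fib_vec n)" "cost t F \<le> (\<Sum>v\<leftarrow>?vs. wt v powr t)"
    using splitting_of_list[OF _ _ t] n by (metis fib_vec_pos)
  obtain z where z: "z \<in> C_set N n" "vec_cost t z \<le> cost t F"
    using C_set_le_cost[OF F(1) t n] critical_ineq_antimono by metis
  have "(\<Sum>v\<leftarrow>?vs. wt v powr t) = (\<Sum>\<beta>\<leftarrow>\<beta>s. wt (factor_exponents p q \<beta>) powr t)"
    by (simp add: o_def)
  also have "\<dots> \<le> (\<Sum>\<beta>\<leftarrow>\<beta>s. log_mahler \<beta> powr t)"
  proof (rule sum_list_mono)
    fix \<beta> assume "\<beta> \<in> set \<beta>s"
    then have "wt (factor_exponents p q \<beta>) \<le> log_mahler \<beta>"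
      using factor_exponents_le_log_mahler[OF p q] \<beta>s unfolding wt_def
      by (metis (mono_tags, lifting) mem_Collect_eq prod.collapse product_representations_def)
    then show "wt (factor_exponents p q \<beta>) powr t \<le> log_mahler \<beta> powr t"
      using t wt_nonneg by (intro powr_mono2) auto
  qed
  finally have "vec_cost t z \<le> (\<Sum>\<beta>\<leftarrow>\<beta>s. log_mahler \<beta> powr t)" using z F by linarith
  then have "f_vec N p q z t \<le> f_rep \<beta>s t"
    unfolding f_vec_eq f_rep_def using t vec_cost_nonneg by (intro powr_mono2) auto
  then show ?thesis using z by blast
qed

lemma metric_mahler_le_f_vec:
  assumes "x \<in> V_set N n" "1 \<le> n"
  shows "metric_mahler t (fib_quot p q n) \<le> f_vec N p q x t"
proof -
  obtain \<beta>s where "\<beta>s \<in> product_representations (fib_quot p q n)" "f_rep \<beta>s t = f_vec N p q x t"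
    using V_set_representation[OF assms] by blast
  moreover have "bdd_below ((\<lambda>\<beta>s. f_rep \<beta>s t) ` product_representations (fib_quot p q n))"
    by (rule bdd_belowI2[of _ 0]) (simp add: f_rep_def)
  ultimately show ?thesis unfolding metric_mahler_def by (metis cINF_lower)
qed

lemma metric_mahler_eq_Min_C_set:
  assumes t: "t > 0" and n: "1 \<le> n" "n \<le> N"
  shows "metric_mahler t (fib_quot p q n) = Min ((\<lambda>x. f_vec N p q x t) ` C_set N n)"
proof (rule antisym)
  have fin: "finite ((\<lambda>x. f_vec N p q x t) ` C_set N n)" by (intro finite_imageI finite_C_set)
  have unit: "(\<lambda>j. if j = n then 1 else 0) \<in> C_set N n"
    using unit_vec_in_S_set S_set_subset_C_set n by blast
  then show "metric_mahler t (fib_quot p q n) \<le> Min ((\<lambda>x. f_vec N p q x t) ` C_set N n)"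
    using fin metric_mahler_le_f_vec n C_set_subset_V_set by (subst Min_ge_iff) blast+
  have "product_representations (fib_quot p q n) \<noteq> {}"
    using V_set_representation unit C_set_subset_V_set n by blast
  then show "Min ((\<lambda>x. f_vec N p q x t) ` C_set N n) \<le> metric_mahler t (fib_quot p q n)"
    unfolding metric_mahler_def
  proof (rule cINF_greatest)
    fix \<beta>s assume "\<beta>s \<in> product_representations (fib_quot p q n)"
    then obtain z where z: "z \<in> C_set N n" "f_vec N p q z t \<le> f_rep \<beta>s t"
      using C_set_le_representation t n by blast
    then have "Min ((\<lambda>x. f_vec N p q x t) ` C_set N n) \<le> f_vec N p q z t"
      by (intro Min_le fin) auto
    with z show "Min ((\<lambda>x. f_vec N p q x t) ` C_set N n) \<le> f_rep \<beta>s t" by simp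
  qed
qed

section \<open>Optimal vectors and the restricted set\<close>

definition C_optimal :: "real \<Rightarrow> nat \<Rightarrow> (nat \<Rightarrow> nat) \<Rightarrow> bool" where
  "C_optimal t n z \<longleftrightarrow> z \<in> C_set N n \<and> (\<forall>y\<in>C_set N n. vec_cost t z \<le> vec_cost t y)"

lemma C_optimal_exists:
  assumes "1 \<le> n" "n \<le> N"
  shows "\<exists>z. C_optimal t n z"
proof -
  have "C_set N n \<noteq> {}" using unit_vec_in_S_set S_set_subset_C_set assms by blast
  then have "Min (vec_cost t ` C_set N n) \<in> vec_cost t ` C_set N n"
    by (intro Min_in finite_imageI finite_C_set) auto
  then obtain z where "z \<in> C_set N n" "vec_cost t z = Min (vec_cost t ` C_set N n)" by auto
  then show ?thesis unfolding C_optimal_def by (metis Min_le finite_C_set finite_imageI image_eqI)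
qed

lemma metric_mahler_eq_if_C_optimal:
  assumes t: "t > 0" and n: "1 \<le> n" "n \<le> N" and z: "C_optimal t n z"
  shows "metric_mahler t (fib_quot p q n) = f_vec N p q z t"
  unfolding metric_mahler_eq_Min_C_set[OF t n]
  using z t by (intro Min_eqI finite_imageI finite_C_set) (auto simp: C_optimal_def f_vec_le_iff)

text \<open>Every vector of \<open>V_set N n\<close> comes from a product representation, so it
  cannot beat the metric Mahler measure, which \<open>z\<close> attains.\<close>

lemma C_optimal_le_V_set:
  assumes t: "t > 0" and n: "1 \<le> n" "n \<le> N" and z: "C_optimal t n z" and y: "y \<in> V_set N n"
  shows "vec_cost t z \<le> vec_cost t y"
  using metric_mahler_le_f_vec[OF y n(1), of t] metric_mahler_eq_if_C_optimal[OF t n z] t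
  by (simp add: f_vec_le_iff)

text \<open>An optimal \<open>s\<close> in \<open>S_set i\<close> costs at most as much as the bad
  factor \<open>x\<close>, while putting \<open>s\<close> for \<open>x\<close> in the optimal
  \<open>z\<close> cannot lower the cost. So both costs agree.\<close>

lemma non_restricted_optimal_coincidence:
  assumes t: "t > 0" and n: "1 \<le> n" "n \<le> N"
    and z: "C_optimal t n z" "z \<notin> R_set N n"
    and S: "\<And>i. 1 \<le> i \<Longrightarrow> i < n \<Longrightarrow>
      metric_mahler t (fib_quot p q i) = Min ((\<lambda>x. f_vec N p q x t) ` S_set i)"
  shows "\<exists>i\<in>{1..n}. \<exists>x\<in>V_set N i. \<exists>s\<in>V_set N i. x \<noteq> s \<and> vec_cost t x = vec_cost t s"
proof -
  have zC: "z \<in> C_set N n" using z(1) by (simp add: C_optimal_def)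
  obtain x i where x: "1 \<le> i" "i < n" "x \<in> V_set N i" "x \<notin> S_set i" "\<And>j. x j \<le> z j"
    using non_restricted_factor[OF zC z(2) n(1)] by blast
  have SV: "S_set i \<subseteq> V_set N i" using S_set_subset_V_set x n by simp
  have fin: "finite (S_set i)" using SV finite_V_set by (rule finite_subset)
  have "S_set i \<noteq> {}" using unit_vec_in_S_set[OF x(1)] by blast
  then have "Min ((\<lambda>x. f_vec N p q x t) ` S_set i) \<in> (\<lambda>x. f_vec N p q x t) ` S_set i"
    using fin by (intro Min_in) auto
  then obtain s where s: "s \<in> S_set i" "metric_mahler t (fib_quot p q i) = f_vec N p q s t"
    using S[OF x(1,2)] by auto
  then have sV: "s \<in> V_set N i" using SV by blast
  have "vec_cost t s \<le> vec_cost t x"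
    using metric_mahler_le_f_vec[OF x(3,1), of t] s(2) t by (simp add: f_vec_le_iff)
  moreover have "vec_cost t z \<le> vec_cost t (\<lambda>j. z j - x j + s j)"
    using zC C_set_subset_V_set x sV
    by (intro C_optimal_le_V_set[OF t n z(1)] V_set_exchange) auto
  moreover have "vec_cost t (\<lambda>j. z j - x j + s j) = vec_cost t z - vec_cost t x + vec_cost t s"
  proof -
    have "real (z j - x j + s j) = real (z j) - real (x j) + real (s j)" for j
      using x(5)[of j] by (simp add: of_nat_diff)
    then show ?thesis by (simp add: vec_cost_def sum_subtractf sum.distrib distrib_right left_diff_distrib)
  qed
  ultimately have "vec_cost t x = vec_cost t s" by linarith
  moreover have "x \<noteq> s" using x s by blast
  ultimately show ?thesis using x(1,2,3) sV by (intro bexI[of _ i] bexI[of _ x] bexI[of _ s]) auto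
qed

text \<open>Otherwise each of the finitely many restricted vectors is strictly beaten at
  \<open>t0\<close>, hence also near \<open>t0\<close> by continuity. Throughout an interval the
  optimal vectors are then not restricted, so all its points lie in the countable set
  \<open>B\<close> of coincidences.\<close>

lemma R_set_optimal_exists:
  assumes t0: "t0 > 0" and n: "1 \<le> n" "n \<le> N"
    and S: "\<And>i t. 1 \<le> i \<Longrightarrow> i < n \<Longrightarrow> t > 0 \<Longrightarrow>
      metric_mahler t (fib_quot p q i) = Min ((\<lambda>x. f_vec N p q x t) ` S_set i)"
  shows "\<exists>z\<in>R_set N n. C_optimal t0 n z"
proof (rule ccontr)
  assume no: "\<not> ?thesis"
  have beaten: "eventually (\<lambda>t. \<not> C_optimal t n z) (nhds t0)" if z: "z \<in> R_set N n" for z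
  proof -
    have "z \<in> C_set N n" using z R_set_subset_C_set by blast
    then obtain y where y: "y \<in> C_set N n" "vec_cost t0 y < vec_cost t0 z"
      using no z by (auto simp: C_optimal_def not_le)
    have "((\<lambda>t. vec_cost t z - vec_cost t y) \<longlongrightarrow> vec_cost t0 z - vec_cost t0 y) (nhds t0)"
      by (intro tendsto_diff tendsto_vec_cost)
    then have "eventually (\<lambda>t. 0 < vec_cost t z - vec_cost t y) (nhds t0)"
      using y(2) by (intro order_tendstoD(1)) auto
    then show ?thesis
      by eventually_elim (use y(1) in \<open>force simp: C_optimal_def\<close>)
  qed
  have "finite (R_set N n)" using finite_C_set R_set_subset_C_set by (rule finite_subset[rotated])
  then have "eventually (\<lambda>t. \<forall>z\<in>R_set N n. \<not> C_optimal t n z) (nhds t0)"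
    using beaten by (simp add: eventually_ball_finite)
  moreover have "eventually (\<lambda>t. t > 0) (nhds t0)"
    using t0 by (rule eventually_nhds_in_open[OF open_greaterThan, unfolded greaterThan_iff])
  ultimately have "eventually (\<lambda>t. t > 0 \<and> (\<forall>z\<in>R_set N n. \<not> C_optimal t n z)) (nhds t0)"
    by eventually_elim auto
  then obtain e where e: "e > 0" "\<And>t. dist t t0 < e \<Longrightarrow> t > 0 \<and> (\<forall>z\<in>R_set N n. \<not> C_optimal t n z)"
    unfolding eventually_nhds_metric by blast
  define B where "B = (\<Union>i\<in>{1..n}. \<Union>x\<in>V_set N i. \<Union>s\<in>V_set N i - {x}. {t. vec_cost t x = vec_cost t s})"
  have "countable B"
    unfolding B_def
    by (intro countable_UN countable_vec_cost_eq countable_finite finite_V_set finite_Diff) (auto simp: V_set_def)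
  moreover have "{t0<..<t0 + e} \<subseteq> B"
  proof
    fix t assume "t \<in> {t0<..<t0 + e}"
    then have t: "t > 0" "\<And>z. z \<in> R_set N n \<Longrightarrow> \<not> C_optimal t n z"
      using e(2)[of t] by (auto simp: dist_real_def)
    obtain z where z: "C_optimal t n z" using C_optimal_exists[OF n] by blast
    then have "z \<notin> R_set N n" using t(2) by blast
    then show "t \<in> B" unfolding B_def
      using non_restricted_optimal_coincidence[OF t(1) n z] S[OF _ _ t(1)] by fastforce
  qed
  moreover have "uncountable {t0<..<t0 + e}" using e(1) by (simp add: uncountable_open_interval)
  ultimately show False using countable_subset by blast
qed

lemma metric_mahler_eq_Min_R_set:
  assumes t: "t > 0" and n: "1 \<le> n" "n \<le> N"
    and S: "\<And>i t. 1 \<le> i \<Longrightarrow> i < n \<Longrightarrow> t > 0 \<Longrightarrow>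
      metric_mahler t (fib_quot p q i) = Min ((\<lambda>x. f_vec N p q x t) ` S_set i)"
  shows "metric_mahler t (fib_quot p q n) = Min ((\<lambda>x. f_vec N p q x t) ` R_set N n)"
proof -
  obtain z where z: "z \<in> R_set N n" "C_optimal t n z"
    using R_set_optimal_exists[OF t n] S by blast
  have "finite (R_set N n)" using finite_C_set R_set_subset_C_set by (rule finite_subset[rotated])
  then have "Min ((\<lambda>x. f_vec N p q x t) ` R_set N n) = f_vec N p q z t"
    using z t by (intro Min_eqI finite_imageI) (auto simp: C_optimal_def f_vec_le_iff R_set_def)
  then show ?thesis using metric_mahler_eq_if_C_optimal[OF t n z(2)] by simp
qed

end

theorem theorem3p1:
  fixes n N :: nat
  assumes "1 \<le> n" and "n \<le> N"
  shows "S_set n \<subseteq> R_set N n \<and> R_set N n \<subseteq> C_set N n \<and> C_set N n \<subseteq> V_set N n \<and>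
    (\<forall>p q :: nat. 3 \<le> N \<and> prime p \<and> prime q \<and> compatible N p q \<longrightarrow>
      (\<forall>t>0. metric_mahler t (fib_quot p q n) = Min ((\<lambda>x. f_vec N p q x t) ` C_set N n)) \<and>
      ((\<forall>i t. 1 \<le> i \<and> i < n \<and> t > 0 \<longrightarrow>
          metric_mahler t (fib_quot p q i) = Min ((\<lambda>x. f_vec N p q x t) ` S_set i)) \<longrightarrow>
       (\<forall>t>0. metric_mahler t (fib_quot p q n) = Min ((\<lambda>x. f_vec N p q x t) ` R_set N n))))"
proof (intro conjI allI impI)
  show "S_set n \<subseteq> R_set N n" using assms by (rule S_set_subset_R_set)
  show "R_set N n \<subseteq> C_set N n" by (rule R_set_subset_C_set)
  show "C_set N n \<subseteq> V_set N n" by (rule C_set_subset_V_set)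
next
  fix p q :: nat and t :: real
  assume "3 \<le> N \<and> prime p \<and> prime q \<and> compatible N p q" "t > 0"
  then interpret compatible_primes N p q by unfold_locales auto
  show "metric_mahler t (fib_quot p q n) = Min ((\<lambda>x. f_vec N p q x t) ` C_set N n)"
    using \<open>t > 0\<close> assms by (rule metric_mahler_eq_Min_C_set)
next
  fix p q :: nat and t :: real
  assume "3 \<le> N \<and> prime p \<and> prime q \<and> compatible N p q" "t > 0"
    and S: "\<forall>i t. 1 \<le> i \<and> i < n \<and> t > 0 \<longrightarrow>
      metric_mahler t (fib_quot p q i) = Min ((\<lambda>x. f_vec N p q x t) ` S_set i)"
  then interpret compatible_primes N p q by unfold_locales auto
  show "metric_mahler t (fib_quot p q n) = Min ((\<lambda>x. f_vec N p q x t) ` R_set N n)"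
    using \<open>t > 0\<close> assms S by (intro metric_mahler_eq_Min_R_set) auto
qed

end
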